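(* Let $\mathfrak B_M\le \mathfrak B_{\widehat M}$ be nested Bratteli diagrams with the same vertex alphabets ($\mathcal A=\widehat{\mathcal A}$) and with edge alphabets $\mathcal E_i\subseteq\widehat{\mathcal E}_i$ for all $i\ge 0$, so that $M\le\widehat M$. Let $\widetilde M$ be the matrix sequence of the canonical cover of $\widehat M$ over $M$, and $\Phi:\Sigma_{\widetilde M}^{0,+}\to\Sigma_{\widehat M}^{0,+}$ the covering map. Then: (i) If $\widehat M$ is primitive and $\Sigma_{\widehat M/M}^{0,+}\neq\Sigma_{\widehat M}^{0,+}$, then $\Sigma_{\widehat M/M}^{0,+}$ is dense with empty interior in $\Sigma_{\widehat M}^{0,+}$. (ii) Order the alphabets so that usual matrices can be used, and order $\widetilde{\mathcal A}_i=\mathcal A_i'\cup\mathcal A_i$ so that the elements of $\mathcal A_i'$ come before those of $\mathcal A_i$. Then $\widetilde M$ has the (rectangular) block form $$\widetilde M_i=\begin{bmatrix}\widehat M_i & C_i\\ 0& M_i\end{bmatrix},\qquad C_i=\widehat M_i-M_i\quad\text{for each } i\ge 0 .$$ (iii) If $\Sigma_M^{0,+}$ is an open subset of $\Sigma_{\widehat M}^{0,+}$, then the tower $\Sigma_{\widehat M/M}^{0,+}$ is an open subset of $\Sigma_{\widehat M}^{0,+}$; indeed it is a countable union of disjoint clopen sets. In particular the cover tower $\Sigma_{\widetilde M/M}^{0,+}$ is an open subset of the cover space $\Sigma_{\widetilde M}^{0,+}$. (iv) The map $\Phi:\Sigma_{\widetilde M}^{0,+}\to\Sigma_{\widehat M}^{0,+}$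 is continuous and surjective, and its restriction to $\Sigma_{\widetilde M/M}^{0,+}$ is a homeomorphism onto $\Sigma_{\widehat M/M}^{0,+}$. Given an order $\widehat{\mathcal O}$ on $\mathfrak B_{\widehat M}$, with $\widetilde{\mathcal O}$ the induced order on $\mathfrak B_{\widetilde M}$, this map conjugates the transformations $T_{\widetilde{\mathcal O}}$ and $T_{\widehat{\mathcal O}}$ on the two towers. The action of $\mathcal{FC}_{\widehat M}$ on $\Sigma_{\widehat M/M}^{0,+}$ lifts to an action of a subgroup of $\mathcal{FC}_{\widetilde M}$ on $\Sigma_{\widetilde M/M}^{0,+}$, which has the same orbit equivalence relation as $\mathcal{FC}_{\widetilde M}$.
   Context: **Diagrams.** $(\mathcal A_i)_{i\ge0}$ is a sequence of finite nonempty sets (alphabets) and $M=(M_i)_{i\ge 0}$ a sequence of $(\mathcal A_i\times\mathcal A_{i+1})$ matrices with nonnegative integer entries. The Bratteli diagram $\mathfrak B_M$ has vertices $\mathcal A_i$ at level $i$ and a set $\mathcal E_i$ of edges from level $i$ to level $i+1$, with $(M_i)_{ab}$ edges $e$ having initial symbol $e^-=a\in\mathcal A_i$ and final symbol $e^+=b\in\mathcal A_{i+1}$. $\Sigma_M^{0,+}$ is the set of infinite edge paths $e=(.e_0e_1\dots)$, $e_i\in\mathcal E_i$, $e_i^+=e_{i+1}^-$, with the topology induced from $\prod_i\mathcal E_i$ (discrete factors). Thin cylinders: $[.e_0\dots e_n]=\{\tilde e:\tilde e_i=e_i,\,0\le i\le n\}$. $M\le\widehat M$ means $\mathcal A_i\subseteq\widehat{\mathcal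 A}_i$ and $(M_i)_{ab}\le(\widehat M_i)_{ab}$ for all $i$ and $a\in\mathcal A_i,b\in\mathcal A_{i+1}$; the edge sets are then taken nested, so $\Sigma_M^{0,+}\subseteq\Sigma_{\widehat M}^{0,+}$, and the base $\Sigma_M^{0,+}$ is assumed nonempty. $M$ is primitive if for every $k$ there is $n>k$ with $M_kM_{k+1}\cdots M_n$ strictly positive. **$\mathcal{FC}_M$** is the group of homeomorphisms of $\Sigma_M^{0,+}$ generated by the involutions which interchange two thin cylinders $[.e_0\dots e_n]$, $[.f_0\dots f_n]$ with $e_n^+=f_n^+$, leaving the tails unchanged (and fixing all other points). **Orders.** An order $\mathcal O$ on $\mathfrak B_M$ is a choice, for each level $i$ and each $b\in\mathcal A_{i+1}$, of a total order on the edges $e\in\mathcal E_i$ with $e^+=b$. For two paths $e,\tilde e$ which agree from some time on, let $k$ be the last index where they differ; then $e<\tilde e$ iff $e_k<\tilde e_k$. $T_{\mathcal O}$ is the partial map sending a path to its successor in this order (where it exists). **Adic tower.** $\Sigma_{\widehat M/M}^{0,+}=\bigcup_{m\ge0}\Sigma_{M^{(m)}}^{0,+}$, where $\Sigma_{M^{(m)}}^{0,+}$ is the set of paths of $\Sigma_{\widehat M}^{0,+}$ with $e_i\in\mathcal E_i$ for all $i>m$. It carries the direct limit topology: $U$ is open iff $U\cap\Sigma_{M^{(m)}}^{0,+}$ is open in $\Sigma_{M^{(m)}}^{0,+}$ for every $m$. **Canonical cover.** Let $\overline{\mathcal E}_i=\widehat{\mathcal E}_i\setminus\mathcal E_i$,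 let $\mathcal A_i'$ be a disjoint copy of $\mathcal A_i$, and let $\widehat{\mathcal E}_i'$ be a disjoint copy of $\widehat{\mathcal E}_i$ (edge $e'$ goes from $a'$ to $b'$ if $e$ goes from $a$ to $b$). For each $\bar e\in\overline{\mathcal E}_i$ from $a$ to $b$ add a new edge $\bar e^\circ$ from $a'\in\mathcal A_i'$ to $b\in\mathcal A_{i+1}$; these form $\overline{\mathcal E}{}^\circ_i$. The canonical cover of $\widehat M$ over $M$ is the diagram with vertices $\widetilde{\mathcal A}_i=\mathcal A_i'\cup\mathcal A_i$ and edges $\widetilde{\mathcal E}_i=\mathcal E_i\cup\overline{\mathcal E}{}_i^\circ\cup\widehat{\mathcal E}_i'$; $\widetilde M$ is its matrix sequence. So $M\le\widetilde M$ via the unprimed vertices and edges, and $\Sigma_{\widetilde M/M}^{0,+}$ is the corresponding tower. The map $\phi$ sends $a,a'\mapsto a$, $e,e'\mapsto e$, $\bar e',\bar e^\circ\mapsto\bar e$, and $\Phi(.\tilde e_0\tilde e_1\dots)=(.\phi(\tilde e_0)\phi(\tilde e_1)\dots)$. Given an order $\widehat{\mathcal O}$ on $\mathfrak B_{\widehat M}$, the induced order $\widetilde{\mathcal O}$ orders the edges $\widehat{\mathcal E}_i'$ entering a primed vertex, and the edges $\mathcal E_i\cup\overline{\mathcal E}{}_i^\circ$ entering an unprimed vertex, as their $\phi$-images are ordered by $\widehat{\mathcal O}$.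
   Formalization: In (iii), openness of the tower and the clopen union are stated under an added assumption: every path of the tower agrees from some time on with a path of the base (true if no M_i has a zero column); without it the claim can fail. The cover tower statement needs no such assumption. *)

theory Defs
  imports
    "HOL-Analysis.Analysis"
    "HOL-Algebra.Generated_Groups"
    "HOL-Algebra.Group_Action"
    "Jordan_Normal_Form.Matrix"
begin

section \<open>Bratteli diagrams and their matrices\<close>

text \<open>The alphabets of different levels may overlap as sets, so the initial symbol
  (\<open>src\<close>) and the final symbol (\<open>tgt\<close>) of an edge depend on the level as well.\<close>

record ('v, 'e) bratteli =
  verts :: "nat \<Rightarrow> 'v set"
  edges :: "nat \<Rightarrow> 'e set"
  src :: "nat \<Rightarrow> 'e \<Rightarrow> 'v"
  tgt :: "nat \<Rightarrow> 'e \<Rightarrow> 'v"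

definition bratteli_diagram :: "('v, 'e) bratteli \<Rightarrow> bool" where
  "bratteli_diagram B \<longleftrightarrow>
     (\<forall>i. finite (verts B i) \<and> verts B i \<noteq> {} \<and> finite (edges B i) \<and>
          (\<forall>e\<in>edges B i. src B i e \<in> verts B i \<and> tgt B i e \<in> verts B (Suc i)))"

definition bmatrix :: "('v, 'e) bratteli \<Rightarrow> nat \<Rightarrow> 'v \<Rightarrow> 'v \<Rightarrow> nat" where
  "bmatrix B i a b = card {e \<in> edges B i. src B i e = a \<and> tgt B i e = b}"

text \<open>The matrix \<open>M\<^sub>i\<close> as a rectangular matrix, once the alphabets are listed in some order.
  The entries are taken in the integers so that matrix subtraction is not truncated.\<close>

definition ordered_matrix ::
    "('v, 'e) bratteli \<Rightarrow> (nat \<Rightarrow> 'v list) \<Rightarrow> nat \<Rightarrow> int Matrix.mat" where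
  "ordered_matrix B as i =
     Matrix.mat (length (as i)) (length (as (Suc i)))
       (\<lambda>(r, c). int (bmatrix B i (as i ! r) (as (Suc i) ! c)))"

text \<open>\<open>bmatrix_prod B k d\<close> is the product \<open>M\<^sub>k M\<^sub>k\<^sub>+\<^sub>1 \<dots> M\<^sub>k\<^sub>+\<^sub>d\<close>.\<close>

primrec bmatrix_prod :: "('v, 'e) bratteli \<Rightarrow> nat \<Rightarrow> nat \<Rightarrow> 'v \<Rightarrow> 'v \<Rightarrow> nat" where
  "bmatrix_prod B k 0 a c = bmatrix B k a c"
| "bmatrix_prod B k (Suc d) a c =
     (\<Sum>b\<in>verts B (Suc (k + d)). bmatrix_prod B k d a b * bmatrix B (Suc (k + d)) b c)"

definition primitive_diagram :: "('v, 'e) bratteli \<Rightarrow> bool" where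
  "primitive_diagram B \<longleftrightarrow>
     (\<forall>k. \<exists>n>k. \<forall>a\<in>verts B k. \<forall>b\<in>verts B (Suc n). 0 < bmatrix_prod B k (n - k) a b)"

definition nested :: "('v, 'e) bratteli \<Rightarrow> ('v, 'e) bratteli \<Rightarrow> bool" where
  "nested B Bh \<longleftrightarrow>
     (\<forall>i. verts B i \<subseteq> verts Bh i \<and> edges B i \<subseteq> edges Bh i \<and>
          (\<forall>e\<in>edges B i. src B i e = src Bh i e \<and> tgt B i e = tgt Bh i e))"

section \<open>Path spaces and adic towers\<close>

definition path_space :: "('v, 'e) bratteli \<Rightarrow> (nat \<Rightarrow> 'e) set" where
  "path_space B = {x. \<forall>i. x i \<in> edges B i \<and> tgt B i (x i) = src B (Suc i) (x (Suc i))}"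

definition path_topology :: "('v, 'e) bratteli \<Rightarrow> (nat \<Rightarrow> 'e) topology" where
  "path_topology B =
     subtopology (product_topology (\<lambda>i. discrete_topology (edges B i)) UNIV) (path_space B)"

definition tower_stage :: "('v, 'e) bratteli \<Rightarrow> ('v, 'e) bratteli \<Rightarrow> nat \<Rightarrow> (nat \<Rightarrow> 'e) set" where
  "tower_stage Bh B m = {x \<in> path_space Bh. \<forall>i>m. x i \<in> edges B i}"

definition tower :: "('v, 'e) bratteli \<Rightarrow> ('v, 'e) bratteli \<Rightarrow> (nat \<Rightarrow> 'e) set" where
  "tower Bh B = (\<Union>m. tower_stage Bh B m)"

definition tower_topology ::
    "('v, 'e) bratteli \<Rightarrow> ('v, 'e) bratteli \<Rightarrow> (nat \<Rightarrow> 'e) topology" where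
  "tower_topology Bh B = topology (\<lambda>U. U \<subseteq> tower Bh B \<and>
     (\<forall>m. openin (subtopology (path_topology Bh) (tower_stage Bh B m))
            (U \<inter> tower_stage Bh B m)))"

lemma openin_tower_topology:
  "openin (tower_topology Bh B) U \<longleftrightarrow> U \<subseteq> tower Bh B \<and>
     (\<forall>m. openin (subtopology (path_topology Bh) (tower_stage Bh B m))
            (U \<inter> tower_stage Bh B m))"
proof -
  let ?S = "\<lambda>m. tower_stage Bh B m"
  let ?X = "\<lambda>m. subtopology (path_topology Bh) (?S m)"
  have "istopology (\<lambda>U. U \<subseteq> tower Bh B \<and> (\<forall>m. openin (?X m) (U \<inter> ?S m)))"
    unfolding istopology_def
  proof (intro conjI allI impI)
    fix S T m
    assume "S \<subseteq> tower Bh B \<and> (\<forall>m. openin (?X m) (S \<inter> ?S m))"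
      and "T \<subseteq> tower Bh B \<and> (\<forall>m. openin (?X m) (T \<inter> ?S m))"
    then have "openin (?X m) ((S \<inter> ?S m) \<inter> (T \<inter> ?S m))"
      by blast
    moreover have "(S \<inter> ?S m) \<inter> (T \<inter> ?S m) = S \<inter> T \<inter> ?S m" by blast
    ultimately show "openin (?X m) (S \<inter> T \<inter> ?S m)" by simp
  next
    fix \<K> m
    assume "\<forall>K\<in>\<K>. K \<subseteq> tower Bh B \<and> (\<forall>m. openin (?X m) (K \<inter> ?S m))"
    then have "openin (?X m) (\<Union>K\<in>\<K>. K \<inter> ?S m)" by blast
    moreover have "(\<Union>K\<in>\<K>. K \<inter> ?S m) = \<Union>\<K> \<inter> ?S m" by blast
    ultimately show "openin (?X m) (\<Union>\<K> \<inter> ?S m)" by simp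
  qed blast+
  then show ?thesis
    unfolding tower_topology_def by (simp add: topology_inverse')
qed

definition eventually_agree :: "(nat \<Rightarrow> 'e) \<Rightarrow> (nat \<Rightarrow> 'e) \<Rightarrow> bool" where
  "eventually_agree x y \<longleftrightarrow> (\<exists>n. \<forall>i\<ge>n. x i = y i)"

text \<open>Every path of the tower agrees from some time on with a path of the base. This can fail
  only through symbols from which an infinite base path starts although no base path from
  level 0 arrives there; in particular it holds if no matrix of the base has a zero column.\<close>

definition base_accessible :: "('v, 'e) bratteli \<Rightarrow> ('v, 'e) bratteli \<Rightarrow> bool" where
  "base_accessible Bh B \<longleftrightarrow> (\<forall>x\<in>tower Bh B. \<exists>y\<in>path_space B. eventually_agree x y)"

section \<open>The group generated by interchanges of thin cylinders\<close>

definition finite_path :: "('v, 'e) bratteli \<Rightarrow> nat \<Rightarrow> (nat \<Rightarrow> 'e) \<Rightarrow> bool" where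
  "finite_path B n e \<longleftrightarrow>
     (\<forall>i\<le>n. e i \<in> edges B i) \<and> (\<forall>i<n. tgt B i (e i) = src B (Suc i) (e (Suc i)))"

definition thin_cylinder :: "('v, 'e) bratteli \<Rightarrow> nat \<Rightarrow> (nat \<Rightarrow> 'e) \<Rightarrow> (nat \<Rightarrow> 'e) set" where
  "thin_cylinder B n e = {x \<in> path_space B. \<forall>i\<le>n. x i = e i}"

definition replace_prefix :: "nat \<Rightarrow> (nat \<Rightarrow> 'e) \<Rightarrow> (nat \<Rightarrow> 'e) \<Rightarrow> (nat \<Rightarrow> 'e)" where
  "replace_prefix n f x = (\<lambda>i. if i \<le> n then f i else x i)"

definition cylinder_swap ::
    "('v, 'e) bratteli \<Rightarrow> nat \<Rightarrow> (nat \<Rightarrow> 'e) \<Rightarrow> (nat \<Rightarrow> 'e) \<Rightarrow> (nat \<Rightarrow> 'e) \<Rightarrow> (nat \<Rightarrow> 'e)" where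
  "cylinder_swap B n e f = (\<lambda>x\<in>path_space B.
     if x \<in> thin_cylinder B n e then replace_prefix n f x
     else if x \<in> thin_cylinder B n f then replace_prefix n e x
     else x)"

definition cylinder_swaps :: "('v, 'e) bratteli \<Rightarrow> ((nat \<Rightarrow> 'e) \<Rightarrow> (nat \<Rightarrow> 'e)) set" where
  "cylinder_swaps B = {cylinder_swap B n e f | n e f.
     finite_path B n e \<and> finite_path B n f \<and> tgt B n (e n) = tgt B n (f n)}"

text \<open>As in \<open>HOL-Algebra.Bij\<close>, the elements are functions extended by \<open>undefined\<close> outside the
  path space. The generating involutions are homeomorphisms, hence so are all elements.\<close>

definition FC :: "('v, 'e) bratteli \<Rightarrow> ((nat \<Rightarrow> 'e) \<Rightarrow> (nat \<Rightarrow> 'e)) monoid" where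
  "FC B = (BijGroup (path_space B))
     \<lparr>carrier := generate (BijGroup (path_space B)) (cylinder_swaps B)\<rparr>"

text \<open>The action of a group of transformations of the path space on an invariant subset \<open>S\<close>.\<close>

definition acts_on :: "(nat \<Rightarrow> 'e) set \<Rightarrow> ((nat \<Rightarrow> 'e) \<Rightarrow> (nat \<Rightarrow> 'e)) \<Rightarrow> ((nat \<Rightarrow> 'e) \<Rightarrow> (nat \<Rightarrow> 'e))"
  where "acts_on S g = restrict g S"

section \<open>Orders and adic transformations\<close>

text \<open>\<open>\<O> i b\<close> is the (reflexive) total order on the edges of level \<open>i\<close> that enter \<open>b\<close>.\<close>

definition bratteli_order ::
    "('v, 'e) bratteli \<Rightarrow> (nat \<Rightarrow> 'v \<Rightarrow> ('e \<times> 'e) set) \<Rightarrow> bool" where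
  "bratteli_order B \<O> \<longleftrightarrow>
     (\<forall>i. \<forall>b\<in>verts B (Suc i). linear_order_on {e \<in> edges B i. tgt B i e = b} (\<O> i b))"

definition path_less ::
    "('v, 'e) bratteli \<Rightarrow> (nat \<Rightarrow> 'v \<Rightarrow> ('e \<times> 'e) set) \<Rightarrow> (nat \<Rightarrow> 'e) \<Rightarrow> (nat \<Rightarrow> 'e) \<Rightarrow> bool" where
  "path_less B \<O> x y \<longleftrightarrow>
     (\<exists>k. (\<forall>i>k. x i = y i) \<and> x k \<noteq> y k \<and> (x k, y k) \<in> \<O> k (tgt B k (y k)))"

definition path_succ ::
    "('v, 'e) bratteli \<Rightarrow> (nat \<Rightarrow> 'v \<Rightarrow> ('e \<times> 'e) set) \<Rightarrow> (nat \<Rightarrow> 'e) \<Rightarrow> (nat \<Rightarrow> 'e) \<Rightarrow> bool" where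
  "path_succ B \<O> x y \<longleftrightarrow> y \<in> path_space B \<and> path_less B \<O> x y \<and>
     \<not> (\<exists>z\<in>path_space B. path_less B \<O> x z \<and> path_less B \<O> z y)"

definition adic_map ::
    "('v, 'e) bratteli \<Rightarrow> (nat \<Rightarrow> 'v \<Rightarrow> ('e \<times> 'e) set) \<Rightarrow> (nat \<Rightarrow> 'e) \<Rightarrow> (nat \<Rightarrow> 'e) option" where
  "adic_map B \<O> x =
     (if \<exists>y. path_succ B \<O> x y then Some (THE y. path_succ B \<O> x y) else None)"

section \<open>The canonical cover\<close>

datatype 'v cover_vert = Vert 'v | Vert' 'v
datatype 'e cover_edge = Edge 'e | Cross 'e | Edge' 'e

text \<open>\<open>Vert'\<close> and \<open>Edge'\<close> are the primed copies; \<open>Cross e\<close> is the new edge from the primed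
  initial symbol of \<open>e\<close> to the unprimed final symbol of \<open>e\<close>.\<close>

primrec cover_src :: "('v, 'e) bratteli \<Rightarrow> nat \<Rightarrow> 'e cover_edge \<Rightarrow> 'v cover_vert" where
  "cover_src Bh i (Edge e) = Vert (src Bh i e)"
| "cover_src Bh i (Cross e) = Vert' (src Bh i e)"
| "cover_src Bh i (Edge' e) = Vert' (src Bh i e)"

primrec cover_tgt :: "('v, 'e) bratteli \<Rightarrow> nat \<Rightarrow> 'e cover_edge \<Rightarrow> 'v cover_vert" where
  "cover_tgt Bh i (Edge e) = Vert (tgt Bh i e)"
| "cover_tgt Bh i (Cross e) = Vert (tgt Bh i e)"
| "cover_tgt Bh i (Edge' e) = Vert' (tgt Bh i e)"

definition canonical_cover ::
    "('v, 'e) bratteli \<Rightarrow> ('v, 'e) bratteli \<Rightarrow> ('v cover_vert, 'e cover_edge) bratteli" where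
  "canonical_cover Bh B =
     \<lparr>verts = (\<lambda>i. Vert' ` verts B i \<union> Vert ` verts B i),
      edges = (\<lambda>i. Edge ` edges B i \<union> Cross ` (edges Bh i - edges B i) \<union> Edge' ` edges Bh i),
      src = cover_src Bh,
      tgt = cover_tgt Bh\<rparr>"

text \<open>The diagram of \<open>M\<close>, viewed inside the cover via the unprimed symbols and edges.\<close>

definition unprimed_base ::
    "('v, 'e) bratteli \<Rightarrow> ('v cover_vert, 'e cover_edge) bratteli" where
  "unprimed_base B =
     \<lparr>verts = (\<lambda>i. Vert ` verts B i),
      edges = (\<lambda>i. Edge ` edges B i),
      src = cover_src B,
      tgt = cover_tgt B\<rparr>"

primrec cover_phi_vert :: "'v cover_vert \<Rightarrow> 'v" where
  "cover_phi_vert (Vert a) = a"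
| "cover_phi_vert (Vert' a) = a"

primrec cover_phi :: "'e cover_edge \<Rightarrow> 'e" where
  "cover_phi (Edge e) = e"
| "cover_phi (Cross e) = e"
| "cover_phi (Edge' e) = e"

definition cover_map :: "(nat \<Rightarrow> 'e cover_edge) \<Rightarrow> (nat \<Rightarrow> 'e)" where
  "cover_map x = (\<lambda>i. cover_phi (x i))"

definition induced_order ::
    "('v, 'e) bratteli \<Rightarrow> ('v, 'e) bratteli \<Rightarrow> (nat \<Rightarrow> 'v \<Rightarrow> ('e \<times> 'e) set) \<Rightarrow>
     nat \<Rightarrow> 'v cover_vert \<Rightarrow> ('e cover_edge \<times> 'e cover_edge) set" where
  "induced_order Bh B \<O> i w =
     {(x, y). x \<in> edges (canonical_cover Bh B) i \<and> cover_tgt Bh i x = w \<and>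
              y \<in> edges (canonical_cover Bh B) i \<and> cover_tgt Bh i y = w \<and>
              (cover_phi x, cover_phi y) \<in> \<O> i (cover_phi_vert w)}"

end

theory Submission
  imports Defs
begin

text \<open>
  The three topological assertions about towers rest on one description of the path topology:
  the cylinders \<open>thin_cylinder B n x\<close> form a basis (\<open>openin_path_topology_iff\<close>). A tower is a union
  of tail classes, and if the diagram is primitive, every tail class meets every cylinder, because
  a strictly positive product of matrices connects the end of any finite prefix to any given tail
  (\<open>primitive_connects_tails\<close>). Hence a nonempty tower is dense; and if some path lies outside the
  tower, its tail class is a dense subset of the complement, so the tower has empty interior. If
  the base is open and every path of the tower shares its tail with a base path, then replacing a
  prefix carries an open neighbourhood inside the base to one inside the tower (\<open>tower_open\<close>).
  Every open set of paths is a disjoint union of countably many clopen sets, obtained by sorting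
  its points by the first level at which their cylinder fits inside (\<open>open_disjoint_clopen_union\<close>).

  Everything about the cover follows from the shape of its paths. An unprimed vertex emits only
  unprimed edges, and the only way from a primed to an unprimed vertex is an edge of the form
  \<open>Cross e\<close> where \<open>e\<close> is not in the base. So a path of the cover is either primed for ever, or it
  runs in the base from some level on; in the latter case it is primed before the last edge outside
  the base, if there is such an edge, and crosses exactly there. In this second case, which characterises the cover tower
  (\<open>mem_cover_tower\<close>), the path is therefore determined by its image under the covering map. This
  defines an inverse of the covering map on the towers (\<open>lift\<close>, \<open>lift_unique\<close>). On a fixed stage
  of the tower a coordinate of the lift depends on finitely many coordinates of the path, which
  makes the inverse continuous (\<open>cover_map_tower_homeomorphic\<close>); in general it depends only on the
  tail beyond that coordinate, so the covering map preserves and reflects the last level at which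
  two paths differ, hence the order and its successors (\<open>cover_path_less_iff\<close>,
  \<open>adic_maps_conjugate\<close>).

  For the groups, all elements of \<open>FC\<close> preserve tails, and conversely two paths with a common tail
  are exchanged by a single swap, so that the orbits are the tail classes
  (\<open>FC_transitive_on_tail_classes\<close>). A path of the cover is determined by its image together with
  its tail class (\<open>fiber_tail_unique\<close>). So every tail-preserving bijection \<open>g\<close> has exactly one
  tail-preserving lift, and uniqueness makes \<open>g \<mapsto> lift_map g\<close> a homomorphism. The preimage of
  a cylinder under the covering map consists of two cylinders, one ending in the primed and one in
  the unprimed copy of the last vertex; so the lift of a swap is the product of two swaps (\<open>lift_map_cylinder_swap\<close>), and
  the homomorphism maps \<open>FC Bh\<close> into \<open>FC\<close> of the cover. The orbits of its image agree with those
  of the whole group since both are the tail classes in the cover tower (\<open>lift_map_orbit\<close>).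
\<close>

section \<open>Cylinders as a basis of the path space\<close>

lemma mem_thin_cylinder [simp]:
  "z \<in> thin_cylinder B n x \<longleftrightarrow> z \<in> path_space B \<and> (\<forall>i\<le>n. z i = x i)"
  by (simp add: thin_cylinder_def)

lemma thin_cylinder_eq:
  "z \<in> thin_cylinder B n x \<Longrightarrow> thin_cylinder B n z = thin_cylinder B n x"
  by (auto simp: thin_cylinder_def)

lemma thin_cylinder_subset: "thin_cylinder B n x \<subseteq> path_space B"
  by (auto simp: thin_cylinder_def)

lemma path_spaceD:
  assumes "x \<in> path_space B"
  shows "x i \<in> edges B i" and "tgt B i (x i) = src B (Suc i) (x (Suc i))"
  using assms by (auto simp: path_space_def)

lemma finite_path_prefix: "x \<in> path_space B \<Longrightarrow> finite_path B n x"
  by (simp add: path_space_def finite_path_def)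

lemma topspace_path_topology [simp]: "topspace (path_topology B) = path_space B"
  by (auto simp: path_topology_def path_space_def PiE_def)

lemma openin_path_topology_iff:
  "openin (path_topology B) U \<longleftrightarrow>
     U \<subseteq> path_space B \<and> (\<forall>x\<in>U. \<exists>n. thin_cylinder B n x \<subseteq> U)"
proof
  assume U: "openin (path_topology B) U"
  then obtain T where
    T: "openin (product_topology (\<lambda>i. discrete_topology (edges B i)) UNIV) T"
      and UT: "U = T \<inter> path_space B"
    by (auto simp: path_topology_def openin_subtopology)
  have "\<exists>n. thin_cylinder B n x \<subseteq> U" if x: "x \<in> U" for x
  proof -
    obtain V where fin: "finite {i. V i \<noteq> edges B i}"
      and xV: "x \<in> Pi\<^sub>E UNIV V" and VT: "Pi\<^sub>E UNIV V \<subseteq> T"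
      using T x unfolding openin_product_topology_alt UT by fastforce
    obtain n where n: "\<And>i. V i \<noteq> edges B i \<Longrightarrow> i \<le> n"
      using fin unfolding finite_nat_set_iff_bounded_le by blast
    have "thin_cylinder B n x \<subseteq> U"
    proof
      fix z assume z: "z \<in> thin_cylinder B n x"
      have "z i \<in> V i" for i
      proof (cases "V i = edges B i")
        case True
        then show ?thesis using z path_spaceD(1)[of z B i] by simp
      next
        case False
        then have "z i = x i" using z n by simp
        then show ?thesis using xV by (auto simp: PiE_def)
      qed
      then show "z \<in> U" using VT UT z by auto
    qed
    then show ?thesis ..
  qed
  then show "U \<subseteq> path_space B \<and> (\<forall>x\<in>U. \<exists>n. thin_cylinder B n x \<subseteq> U)"
    using UT by blast
next
  assume U: "U \<subseteq> path_space B \<and> (\<forall>x\<in>U. \<exists>n. thin_cylinder B n x \<subseteq> U)"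
  have "openin (path_topology B) (thin_cylinder B n x)" if "x \<in> path_space B" for n x
  proof -
    let ?V = "\<lambda>i. if i \<le> n then {x i} else edges B i"
    have "finite {i. ?V i \<noteq> edges B i}"
      by (rule finite_subset[of _ "{..n}"]) auto
    then have "openin (product_topology (\<lambda>i. discrete_topology (edges B i)) UNIV) (Pi\<^sub>E UNIV ?V)"
      using that by (auto simp: openin_PiE_gen path_space_def)
    moreover have "thin_cylinder B n x = Pi\<^sub>E UNIV ?V \<inter> path_space B"
      by (auto simp: path_space_def PiE_def Pi_def split: if_splits)
    ultimately show ?thesis
      by (auto simp: path_topology_def openin_subtopology)
  qed
  note cylinder = this
  show "openin (path_topology B) U"
  proof (subst openin_subopen, intro ballI)
    fix x assume x: "x \<in> U"
    then obtain n where "thin_cylinder B n x \<subseteq> U" and "x \<in> path_space B" using U by blast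
    then show "\<exists>T. openin (path_topology B) T \<and> x \<in> T \<and> T \<subseteq> U"
      by (intro exI[of _ "thin_cylinder B n x"]) (simp add: cylinder)
  qed
qed

text \<open>The direct limit topology is tested on each stage separately, and the cylinder that witnesses
  openness at a point may depend on the stage.\<close>

lemma openin_tower_topology_iff:
  "openin (tower_topology Bh B) U \<longleftrightarrow> U \<subseteq> tower Bh B \<and>
     (\<forall>m. \<forall>x\<in>U \<inter> tower_stage Bh B m. \<exists>n. thin_cylinder Bh n x \<inter> tower_stage Bh B m \<subseteq> U)"
    (is "_ \<longleftrightarrow> _ \<and> (\<forall>m. ?P m)")
proof -
  have "openin (subtopology (path_topology Bh) (tower_stage Bh B m)) (U \<inter> tower_stage Bh B m)
    \<longleftrightarrow> ?P m" (is "openin (subtopology _ ?S) _ \<longleftrightarrow> _") for m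
  proof
    assume "openin (subtopology (path_topology Bh) ?S) (U \<inter> ?S)"
    then obtain T where "openin (path_topology Bh) T" and T: "U \<inter> ?S = T \<inter> ?S"
      by (auto simp: openin_subtopology)
    then have nbhd: "\<forall>x\<in>T. \<exists>n. thin_cylinder Bh n x \<subseteq> T"
      by (simp add: openin_path_topology_iff)
    show "?P m"
    proof
      fix x assume "x \<in> U \<inter> ?S"
      then obtain n where "thin_cylinder Bh n x \<subseteq> T" using nbhd T by blast
      then have "thin_cylinder Bh n x \<inter> ?S \<subseteq> U" using T by blast
      then show "\<exists>n. thin_cylinder Bh n x \<inter> ?S \<subseteq> U" ..
    qed
  next
    assume P: "?P m"
    let ?T = "{x \<in> path_space Bh. \<exists>n. thin_cylinder Bh n x \<inter> ?S \<subseteq> U}"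
    have "openin (path_topology Bh) ?T"
      unfolding openin_path_topology_iff
    proof (intro conjI ballI)
      fix x assume "x \<in> ?T"
      then obtain n where n: "thin_cylinder Bh n x \<inter> ?S \<subseteq> U" by blast
      have "thin_cylinder Bh n x \<subseteq> ?T"
        using n thin_cylinder_eq thin_cylinder_subset by fast
      then show "\<exists>n. thin_cylinder Bh n x \<subseteq> ?T" ..
    qed blast
    moreover have "U \<inter> ?S = ?T \<inter> ?S"
      using P by (fastforce simp: tower_stage_def)
    ultimately show "openin (subtopology (path_topology Bh) ?S) (U \<inter> ?S)"
      by (auto simp: openin_subtopology)
  qed
  then show ?thesis unfolding openin_tower_topology by (simp only:)
qed

lemma tower_stage_subset: "tower_stage Bh B m \<subseteq> tower Bh B"
  by (auto simp: tower_def)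

lemma topspace_tower_topology [simp]: "topspace (tower_topology Bh B) = tower Bh B"
proof
  show "topspace (tower_topology Bh B) \<subseteq> tower Bh B"
    by (metis openin_topspace openin_tower_topology)
  have "openin (tower_topology Bh B) (tower Bh B)"
    unfolding openin_tower_topology_iff
  proof (intro conjI allI ballI exI)
    show "thin_cylinder Bh 0 x \<inter> tower_stage Bh B m \<subseteq> tower Bh B" for x m
      using tower_stage_subset by fast
  qed simp
  then show "tower Bh B \<subseteq> topspace (tower_topology Bh B)"
    by (rule openin_subset)
qed

lemma mem_tower:
  "x \<in> tower Bh B \<longleftrightarrow> x \<in> path_space Bh \<and> (\<exists>m. \<forall>i>m. x i \<in> edges B i)"
  by (auto simp: tower_def tower_stage_def)

text \<open>Whether the cylinder of length \<open>n\<close> around \<open>x\<close> is contained in \<open>U\<close> depends only on the first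
  coordinates of \<open>x\<close>. So the points for which it is contained form a clopen set. These sets exhaust
  \<open>U\<close>, and successive differences make them disjoint.\<close>

lemma open_disjoint_clopen_union:
  assumes "openin (path_topology B) U"
  shows "\<exists>\<U>. countable \<U> \<and> disjoint \<U> \<and>
     (\<forall>V\<in>\<U>. openin (path_topology B) V \<and> closedin (path_topology B) V) \<and> \<Union>\<U> = U"
proof -
  define V where "V n = {x \<in> path_space B. thin_cylinder B n x \<subseteq> U}" for n
  have V_iff: "z \<in> V n \<longleftrightarrow> x \<in> V n" if "z \<in> thin_cylinder B n x" "x \<in> path_space B" for n x z
    using that thin_cylinder_eq[OF that(1)] by (simp add: V_def)
  have op: "openin (path_topology B) (V n)" for n
    unfolding openin_path_topology_iff
  proof (intro conjI ballI exI subsetI)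
    fix x z assume x: "x \<in> V n" and "z \<in> thin_cylinder B n x"
    then show "z \<in> V n" using V_iff[of z n x] by (auto simp: V_def)
  qed (simp add: V_def)
  have "openin (path_topology B) (path_space B - V n)" for n
    unfolding openin_path_topology_iff
  proof (intro conjI ballI exI subsetI)
    fix x z assume "x \<in> path_space B - V n" and z: "z \<in> thin_cylinder B n x"
    then show "z \<in> path_space B - V n" using V_iff[OF z] by simp
  qed simp
  then have cl: "closedin (path_topology B) (V n)" for n
    by (auto simp: closedin_def V_def)
  have clopen: "openin (path_topology B) (disjointed V n) \<and>
      closedin (path_topology B) (disjointed V n)" for n
    unfolding disjointed_def
    by (intro conjI openin_diff closedin_diff openin_Union closedin_Union op cl)
       (auto intro: op cl)
  have "(\<Union>n. V n) = U"
  proof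
    show "(\<Union>n. V n) \<subseteq> U" by (auto simp: V_def)
    show "U \<subseteq> (\<Union>n. V n)"
      using assms unfolding openin_path_topology_iff V_def by blast
  qed
  then have "\<Union>(range (disjointed V)) = U"
    by (simp add: UN_disjointed_eq)
  moreover have "disjoint (range (disjointed V))"
    using disjoint_family_disjointed[of V]
    by (rule disjoint_family_on_disjoint_image)
  ultimately show ?thesis
    using clopen by (intro exI[of _ "range (disjointed V)"]) auto
qed

section \<open>Tail equivalence and splicing of paths\<close>

lemma eventually_agree_refl [simp]: "eventually_agree x x"
  by (simp add: eventually_agree_def)

lemma eventually_agree_sym: "eventually_agree x y \<Longrightarrow> eventually_agree y x"
  unfolding eventually_agree_def by metis

lemma eventually_agree_trans:
  assumes "eventually_agree x y" and "eventually_agree y z"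
  shows "eventually_agree x z"
proof -
  obtain m n where "\<forall>i\<ge>m. x i = y i" and "\<forall>i\<ge>n. y i = z i"
    using assms by (auto simp: eventually_agree_def)
  then have "\<forall>i\<ge>max m n. x i = z i" by simp
  then show ?thesis unfolding eventually_agree_def by blast
qed

lemma eventually_agree_replace_prefix [simp]: "eventually_agree (replace_prefix n f x) x"
  unfolding eventually_agree_def replace_prefix_def by (rule exI[of _ "Suc n"]) auto

text \<open>Splicing at a common vertex is the only construction of new paths: swaps, density and openness
  of the towers all use it.\<close>

lemma replace_prefix_path:
  assumes "finite_path B n f" and "y \<in> path_space B"
    and "tgt B n (f n) = src B (Suc n) (y (Suc n))"
  shows "replace_prefix n f y \<in> path_space B"
proof -
  have "replace_prefix n f y i \<in> edges B i \<and>
      tgt B i (replace_prefix n f y i) = src B (Suc i) (replace_prefix n f y (Suc i))" for i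
    using assms path_spaceD[OF assms(2), of i]
    by (cases i n rule: linorder_cases) (auto simp: replace_prefix_def finite_path_def)
  then show ?thesis by (simp add: path_space_def)
qed

text \<open>Towers are unions of tail classes, which is what makes them invariant under the adic
  transformations and under \<open>FC\<close>.\<close>

lemma tower_tail_closed:
  assumes "x \<in> tower Bh B" and "y \<in> path_space Bh" and "eventually_agree y x"
  shows "y \<in> tower Bh B"
proof -
  obtain m where m: "\<forall>i>m. x i \<in> edges B i" using assms(1) by (auto simp: mem_tower)
  obtain n where n: "\<forall>i\<ge>n. y i = x i" using assms(3) by (auto simp: eventually_agree_def)
  have "\<forall>i>max m n. y i \<in> edges B i" using m n by simp
  then show ?thesis using assms(2) unfolding mem_tower by blast
qed

lemma bmatrix_pos: "0 < bmatrix B i a b \<Longrightarrow> \<exists>e\<in>edges B i. src B i e = a \<and> tgt B i e = b"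
  unfolding bmatrix_def by (metis (mono_tags, lifting) card_gt_0_iff equals0I mem_Collect_eq)

lemma bmatrix_prod_pos_path:
  assumes "0 < bmatrix_prod B k d a c"
  shows "\<exists>p. (\<forall>i\<in>{k..k + d}. p i \<in> edges B i) \<and>
     (\<forall>i\<in>{k..<k + d}. tgt B i (p i) = src B (Suc i) (p (Suc i))) \<and>
     src B k (p k) = a \<and> tgt B (k + d) (p (k + d)) = c"
  using assms
proof (induction d arbitrary: c)
  case 0
  then obtain e where "e \<in> edges B k" "src B k e = a" "tgt B k e = c"
    using bmatrix_pos[of B k a c] by auto
  then show ?case by (intro exI[of _ "\<lambda>_. e"]) auto
next
  case (Suc d)
  then obtain b where "0 < bmatrix_prod B k d a b" and b: "0 < bmatrix B (Suc (k + d)) b c"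
  proof -
    have "(\<Sum>b\<in>verts B (Suc (k + d)). bmatrix_prod B k d a b * bmatrix B (Suc (k + d)) b c) \<noteq> 0"
      using Suc.prems by simp
    then obtain b where "bmatrix_prod B k d a b * bmatrix B (Suc (k + d)) b c \<noteq> 0"
      by (meson sum.neutral)
    then show thesis using that[of b] by simp
  qed
  with Suc.IH obtain p where p: "\<forall>i\<in>{k..k + d}. p i \<in> edges B i"
      "\<forall>i\<in>{k..<k + d}. tgt B i (p i) = src B (Suc i) (p (Suc i))"
      "src B k (p k) = a" "tgt B (k + d) (p (k + d)) = b"
    by blast
  obtain e where e: "e \<in> edges B (Suc (k + d))"
      "src B (Suc (k + d)) e = b" "tgt B (Suc (k + d)) e = c"
    using bmatrix_pos[OF b] by blast
  show ?case
    using p e by (intro exI[of _ "p(Suc (k + d) := e)"]) (auto simp: le_Suc_eq less_Suc_eq)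
qed

text \<open>After the prefix of \<open>x\<close> up to level \<open>n\<close>, positivity of a product of matrices provides a finite
  path to the vertex from which the remaining tail of \<open>y\<close> starts.\<close>

lemma primitive_connects_tails:
  assumes B: "bratteli_diagram B" and prim: "primitive_diagram B"
    and x: "x \<in> path_space B" and y: "y \<in> path_space B"
  shows "\<exists>z\<in>thin_cylinder B n x. eventually_agree z y"
proof -
  obtain m where m: "m > Suc n" and pos: "\<forall>a\<in>verts B (Suc n). \<forall>b\<in>verts B (Suc m).
      0 < bmatrix_prod B (Suc n) (m - Suc n) a b"
    using prim unfolding primitive_diagram_def by blast
  have "tgt B n (x n) \<in> verts B (Suc n)" "src B (Suc m) (y (Suc m)) \<in> verts B (Suc m)"
    using B path_spaceD(1)[OF x, of n] path_spaceD(1)[OF y, of "Suc m"]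
    unfolding bratteli_diagram_def by blast+
  with pos have "0 < bmatrix_prod B (Suc n) (m - Suc n) (tgt B n (x n)) (src B (Suc m) (y (Suc m)))"
    by blast
  from bmatrix_prod_pos_path[OF this] obtain p where p: "\<forall>i\<in>{Suc n..m}. p i \<in> edges B i"
      "\<forall>i\<in>{Suc n..<m}. tgt B i (p i) = src B (Suc i) (p (Suc i))"
      "src B (Suc n) (p (Suc n)) = tgt B n (x n)" "tgt B m (p m) = src B (Suc m) (y (Suc m))"
    using m by auto
  define q where "q = replace_prefix n x p"
  have qi: "q i = (if i \<le> n then x i else p i)" for i
    by (simp add: q_def replace_prefix_def)
  have "finite_path B m q"
    unfolding finite_path_def
  proof (intro conjI allI impI)
    fix i assume "i \<le> m"
    then show "q i \<in> edges B i" using p(1) path_spaceD(1)[OF x] by (simp add: qi)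
  next
    fix i assume "i < m"
    then show "tgt B i (q i) = src B (Suc i) (q (Suc i))"
      using p(2,3) path_spaceD(2)[OF x] by (cases i n rule: linorder_cases) (auto simp: qi)
  qed
  then have "replace_prefix m q y \<in> path_space B"
    using p(4) m y by (intro replace_prefix_path) (auto simp: qi)
  moreover have "\<forall>i\<le>n. replace_prefix m q y i = x i"
    using m by (simp add: replace_prefix_def qi)
  ultimately show ?thesis
    by (intro bexI[of _ "replace_prefix m q y"]) auto
qed

lemma primitive_tail_class_dense:
  assumes B: "bratteli_diagram B" and prim: "primitive_diagram B" and y: "y \<in> path_space B"
    and S: "\<And>z. z \<in> path_space B \<Longrightarrow> eventually_agree z y \<Longrightarrow> z \<in> S"
  shows "path_topology B closure_of S = path_space B"
proof
  show "path_topology B closure_of S \<subseteq> path_space B"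
    using closure_of_subset_topspace[of "path_topology B" S] by simp
  show "path_space B \<subseteq> path_topology B closure_of S"
  proof
    fix x assume x: "x \<in> path_space B"
    have "\<exists>z\<in>S. z \<in> T" if "x \<in> T" and "openin (path_topology B) T" for T
    proof -
      obtain n where "thin_cylinder B n x \<subseteq> T"
        using \<open>x \<in> T\<close> \<open>openin (path_topology B) T\<close> unfolding openin_path_topology_iff by blast
      moreover obtain z where z: "z \<in> thin_cylinder B n x" "eventually_agree z y"
        using primitive_connects_tails[OF B prim x y] by blast
      moreover have "z \<in> S" using S z thin_cylinder_subset by blast
      ultimately show ?thesis by blast
    qed
    then show "x \<in> path_topology B closure_of S"
      using x by (auto simp: in_closure_of)
  qed
qed

section \<open>Tail-preserving bijections and orbits\<close>

text \<open>A subgroup of \<open>BijGroup\<close> that contains \<open>FC B\<close> and is defined without generators. Lifting to the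
  cover is possible, and is seen to be a homomorphism, already on this larger group.\<close>

definition tail_bijections :: "('v, 'e) bratteli \<Rightarrow> ((nat \<Rightarrow> 'e) \<Rightarrow> (nat \<Rightarrow> 'e)) set" where
  "tail_bijections B =
     {g \<in> Bij (path_space B). \<forall>x\<in>path_space B. eventually_agree (g x) x}"

lemma tail_bijectionsD:
  assumes "g \<in> tail_bijections B"
  shows "g \<in> Bij (path_space B)" and "x \<in> path_space B \<Longrightarrow> g x \<in> path_space B"
    and "x \<in> path_space B \<Longrightarrow> eventually_agree (g x) x"
  using assms Bij_imp_funcset by (auto simp: tail_bijections_def)

lemma subgroup_tail_bijections: "subgroup (tail_bijections B) (BijGroup (path_space B))"
proof (rule group.subgroupI[OF group_BijGroup])
  let ?S = "path_space B"
  show "tail_bijections B \<subseteq> carrier (BijGroup ?S)"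
    by (auto simp: tail_bijections_def BijGroup_def)
  have "(\<lambda>x\<in>?S. x) \<in> tail_bijections B"
    by (simp add: tail_bijections_def id_Bij)
  then show "tail_bijections B \<noteq> {}" by blast
next
  let ?S = "path_space B"
  fix g assume g: "g \<in> tail_bijections B"
  have "eventually_agree (inv_into ?S g x) x" if x: "x \<in> ?S" for x
  proof -
    have "inv_into ?S g x \<in> ?S" and "g (inv_into ?S g x) = x"
      using tail_bijectionsD(1)[OF g] x
      by (auto simp: Bij_def bij_betw_def inv_into_into f_inv_into_f)
    then show ?thesis
      using tail_bijectionsD(3)[OF g] by (metis eventually_agree_sym)
  qed
  then show "inv\<^bsub>BijGroup ?S\<^esub> g \<in> tail_bijections B"
    using tail_bijectionsD(1)[OF g]
    by (simp add: inv_BijGroup tail_bijections_def restrict_inv_into_Bij)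
next
  let ?S = "path_space B"
  fix g h assume g: "g \<in> tail_bijections B" and h: "h \<in> tail_bijections B"
  have "eventually_agree (g (h x)) x" if x: "x \<in> ?S" for x
    by (rule eventually_agree_trans[OF tail_bijectionsD(3)[OF g] tail_bijectionsD(3)[OF h]])
       (use x tail_bijectionsD(2)[OF h] in auto)
  then show "g \<otimes>\<^bsub>BijGroup ?S\<^esub> h \<in> tail_bijections B"
    using tail_bijectionsD(1)[OF g] tail_bijectionsD(1)[OF h]
    by (simp add: BijGroup_def tail_bijections_def compose_Bij) (simp add: compose_def)
qed

lemma cylinder_swap_apply:
  "x \<in> path_space B \<Longrightarrow> cylinder_swap B n e f x =
     (if \<forall>i\<le>n. x i = e i then replace_prefix n f x
      else if \<forall>i\<le>n. x i = f i then replace_prefix n e x else x)"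
  by (simp only: cylinder_swap_def restrict_apply if_True mem_thin_cylinder simp_thms)

lemma cylinder_swap_tail_bijection:
  assumes e: "finite_path B n e" and f: "finite_path B n f"
    and ef: "tgt B n (e n) = tgt B n (f n)"
  shows "cylinder_swap B n e f \<in> tail_bijections B"
proof -
  let ?s = "cylinder_swap B n e f"
  have mem: "?s x \<in> path_space B" if x: "x \<in> path_space B" for x
  proof -
    have "replace_prefix n f x \<in> path_space B" if "\<forall>i\<le>n. x i = e i"
      using that path_spaceD(2)[OF x, of n] ef by (intro replace_prefix_path f x) simp
    moreover have "replace_prefix n e x \<in> path_space B" if "\<forall>i\<le>n. x i = f i"
      using that path_spaceD(2)[OF x, of n] ef by (intro replace_prefix_path e x) simp
    ultimately show ?thesis
      unfolding cylinder_swap_apply[OF x] using x by (split if_split, split if_split) blast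
  qed
  have invol: "?s (?s x) = x" if x: "x \<in> path_space B" for x
  proof -
    consider "\<forall>i\<le>n. x i = e i" | "\<not> (\<forall>i\<le>n. x i = e i)" "\<forall>i\<le>n. x i = f i"
      | "\<not> (\<forall>i\<le>n. x i = e i)" "\<not> (\<forall>i\<le>n. x i = f i)" by blast
    then show ?thesis
    proof cases
      case 1
      then have s: "?s x = replace_prefix n f x"
        unfolding cylinder_swap_apply[OF x] by (split if_split, split if_split) blast
      have "replace_prefix n f x \<in> path_space B" using mem[OF x] s by simp
      from cylinder_swap_apply[OF this, of n e f] show ?thesis
        using 1 unfolding s by (auto simp: replace_prefix_def fun_eq_iff)
    next
      case 2
      then have s: "?s x = replace_prefix n e x"
        unfolding cylinder_swap_apply[OF x] by (split if_split, split if_split) blast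
      have "replace_prefix n e x \<in> path_space B" using mem[OF x] s by simp
      from cylinder_swap_apply[OF this, of n e f] show ?thesis
        using 2 unfolding s by (auto simp: replace_prefix_def fun_eq_iff)
    next
      case 3
      then have s: "?s x = x"
        unfolding cylinder_swap_apply[OF x] by (split if_split, split if_split) blast
      then show ?thesis by simp
    qed
  qed
  have "bij_betw ?s (path_space B) (path_space B)"
    by (rule bij_betw_byWitness[where f' = ?s]) (use mem invol in auto)
  moreover have "?s \<in> extensional (path_space B)" by (simp add: cylinder_swap_def)
  moreover have "eventually_agree (?s x) x" if "x \<in> path_space B" for x
    unfolding cylinder_swap_apply[OF that] by (split if_split, split if_split) simp
  ultimately show ?thesis by (simp add: tail_bijections_def Bij_def)
qed

lemma cylinder_swaps_subset: "cylinder_swaps B \<subseteq> tail_bijections B"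
  using cylinder_swap_tail_bijection by (auto simp: cylinder_swaps_def)

lemma carrier_FC: "carrier (FC B) = generate (BijGroup (path_space B)) (cylinder_swaps B)"
  by (simp add: FC_def)

lemma FC_subset_tail_bijections: "carrier (FC B) \<subseteq> tail_bijections B"
  unfolding carrier_FC
  by (rule group.generate_subgroup_incl[OF group_BijGroup cylinder_swaps_subset subgroup_tail_bijections])

lemma FC_subgroup: "subgroup (carrier (FC B)) (BijGroup (path_space B))"
  unfolding carrier_FC
  using cylinder_swaps_subset subgroup.subset[OF subgroup_tail_bijections]
  by (intro group.generate_is_subgroup[OF group_BijGroup]) blast

lemma group_FC: "group (FC B)"
  using group.subgroup_imp_group[OF group_BijGroup FC_subgroup, of B] by (simp add: FC_def)

lemma mult_FC:
  assumes "g \<in> carrier (FC B)" and "h \<in> carrier (FC B)"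
  shows "g \<otimes>\<^bsub>FC B\<^esub> h = compose (path_space B) g h"
proof -
  have "g \<in> Bij (path_space B)" "h \<in> Bij (path_space B)"
    using assms FC_subset_tail_bijections tail_bijectionsD(1) by blast+
  then show ?thesis by (simp add: FC_def BijGroup_def)
qed

text \<open>Tail-preserving bijections map a union of tail classes onto itself; surjectivity holds because a
  preimage of a point shares its tail.\<close>

lemma FC_acts_on_tail_closed:
  assumes S: "S \<subseteq> path_space B"
    and closed: "\<And>x y. x \<in> S \<Longrightarrow> y \<in> path_space B \<Longrightarrow> eventually_agree y x \<Longrightarrow> y \<in> S"
  shows "group_action (FC B) S (acts_on S)"
proof -
  have bij: "acts_on S g \<in> Bij S" if "g \<in> carrier (FC B)" for g
  proof -
    have g: "g \<in> tail_bijections B" using that FC_subset_tail_bijections by blast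
    have bg: "bij_betw g (path_space B) (path_space B)"
      using tail_bijectionsD(1)[OF g] by (simp add: Bij_def)
    have "g ` S = S"
    proof
      show "g ` S \<subseteq> S" using closed S tail_bijectionsD(2,3)[OF g] by blast
      show "S \<subseteq> g ` S"
      proof
        fix y assume y: "y \<in> S"
        then obtain x where x: "x \<in> path_space B" "y = g x"
          using bg S by (auto simp: bij_betw_def)
        then have "x \<in> S"
          using closed[OF y] tail_bijectionsD(3)[OF g] eventually_agree_sym by blast
        then show "y \<in> g ` S" using x by blast
      qed
    qed
    then have "bij_betw g S S"
      using bg S by (auto simp: bij_betw_def intro: inj_on_subset)
    then show ?thesis
      by (simp add: acts_on_def Bij_def cong: bij_betw_cong)
  qed
  have "acts_on S \<in> hom (FC B) (BijGroup S)"
  proof (rule homI)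
    fix g assume "g \<in> carrier (FC B)"
    then show "acts_on S g \<in> carrier (BijGroup S)" using bij by (simp add: BijGroup_def)
  next
    fix g h assume gh: "g \<in> carrier (FC B)" "h \<in> carrier (FC B)"
    have "h x \<in> S" if "x \<in> S" for x
      using bij[OF gh(2)] that by (auto simp: acts_on_def Bij_def bij_betw_def)
    then show "acts_on S (g \<otimes>\<^bsub>FC B\<^esub> h) = acts_on S g \<otimes>\<^bsub>BijGroup S\<^esub> acts_on S h"
      using S bij[OF gh(1)] bij[OF gh(2)] gh
      by (auto simp: mult_FC BijGroup_def compose_def acts_on_def restrict_def fun_eq_iff subset_iff)
  qed
  then show ?thesis
    by (intro group_action.intro group_hom.intro group_FC group_BijGroup group_hom_axioms.intro)
qed

lemma FC_acts_on_tower: "group_action (FC Bh) (tower Bh B) (acts_on (tower Bh B))"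
proof (rule FC_acts_on_tail_closed)
  show "tower Bh B \<subseteq> path_space Bh" by (auto simp: mem_tower)
qed (rule tower_tail_closed)

text \<open>The swap of the two prefixes up to a level after which the paths agree moves one path to the
  other.\<close>

lemma FC_transitive_on_tail_classes:
  assumes x: "x \<in> path_space B" and y: "y \<in> path_space B" and "eventually_agree x y"
  shows "\<exists>g\<in>carrier (FC B). g x = y"
proof -
  obtain n where n: "\<forall>i\<ge>n. x i = y i" using assms(3) by (auto simp: eventually_agree_def)
  have "tgt B n (x n) = tgt B n (y n)" using n by simp
  then have "cylinder_swap B n x y \<in> cylinder_swaps B"
    using finite_path_prefix[OF x] finite_path_prefix[OF y] unfolding cylinder_swaps_def by blast
  then have "cylinder_swap B n x y \<in> carrier (FC B)"
    unfolding carrier_FC by (rule generate.incl)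
  moreover have "cylinder_swap B n x y x = y"
    using n unfolding cylinder_swap_apply[OF x] replace_prefix_def by auto
  ultimately show ?thesis by blast
qed


section \<open>Successors in the path order\<close>

lemma path_less_eventually_agree: "path_less B \<O> x y \<Longrightarrow> eventually_agree x y"
  unfolding path_less_def eventually_agree_def by (metis Suc_le_lessD)

text \<open>At the last level where the paths differ, the two edges enter the same vertex, because the paths
  agree afterwards; there the order of the diagram compares them.\<close>

lemma path_less_total:
  assumes B: "bratteli_diagram B" and ord: "bratteli_order B \<O>"
    and x: "x \<in> path_space B" and y: "y \<in> path_space B"
    and "eventually_agree x y" and "x \<noteq> y"
  shows "path_less B \<O> x y \<or> path_less B \<O> y x"
proof -
  define n where "n = (LEAST n. \<forall>i\<ge>n. x i = y i)"
  have n: "\<forall>i\<ge>n. x i = y i"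
    unfolding n_def using assms(5) unfolding eventually_agree_def by (rule LeastI_ex)
  have "n \<noteq> 0" using n assms(6) by auto
  then obtain k where k: "n = Suc k" by (cases n) auto
  have "\<not> (\<forall>i\<ge>k. x i = y i)"
    using not_less_Least[of k "\<lambda>n. \<forall>i\<ge>n. x i = y i"] k n_def by simp
  then have ne: "x k \<noteq> y k" using n k by (metis le_antisym not_less_eq_eq)
  let ?b = "tgt B k (y k)"
  have tgt: "tgt B k (x k) = ?b"
    using n k path_spaceD(2)[OF x, of k] path_spaceD(2)[OF y, of k] by simp
  have "?b \<in> verts B (Suc k)"
    using B path_spaceD(1)[OF y, of k] unfolding bratteli_diagram_def by blast
  then have "linear_order_on {e \<in> edges B k. tgt B k e = ?b} (\<O> k ?b)"
    using ord unfolding bratteli_order_def by blast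
  then have "(x k, y k) \<in> \<O> k ?b \<or> (y k, x k) \<in> \<O> k ?b"
    using ne tgt path_spaceD(1)[OF x, of k] path_spaceD(1)[OF y, of k]
    unfolding linear_order_on_def total_on_def by blast
  moreover have "\<forall>i>k. x i = y i" using n k by auto
  ultimately show ?thesis
    using ne tgt unfolding path_less_def by metis
qed

lemma path_succ_unique:
  assumes B: "bratteli_diagram B" and ord: "bratteli_order B \<O>"
    and y: "path_succ B \<O> x y" and z: "path_succ B \<O> x z"
  shows "y = z"
proof (rule ccontr)
  assume ne: "y \<noteq> z"
  have "eventually_agree x y" "eventually_agree x z"
    using y z path_less_eventually_agree unfolding path_succ_def by blast+
  then have "eventually_agree y z"
    using eventually_agree_sym eventually_agree_trans by blast
  moreover have "y \<in> path_space B" "z \<in> path_space B"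
    using y z unfolding path_succ_def by blast+
  ultimately have "path_less B \<O> y z \<or> path_less B \<O> z y"
    using path_less_total[OF B ord] ne by blast
  then show False using y z unfolding path_succ_def by blast
qed

lemma adic_map_Some_iff:
  assumes "\<And>y z. path_succ B \<O> x y \<Longrightarrow> path_succ B \<O> x z \<Longrightarrow> y = z"
  shows "adic_map B \<O> x = Some y \<longleftrightarrow> path_succ B \<O> x y"
proof
  assume "adic_map B \<O> x = Some y"
  then have ex: "\<exists>y. path_succ B \<O> x y" and "y = (THE y. path_succ B \<O> x y)"
    unfolding adic_map_def by (auto split: if_splits)
  then show "path_succ B \<O> x y"
    using assms by (metis the_equality)
next
  assume y: "path_succ B \<O> x y"
  then have "(THE y. path_succ B \<O> x y) = y"
    using assms by blast
  then show "adic_map B \<O> x = Some y"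
    using y unfolding adic_map_def by auto
qed

section \<open>Lifting paths to the canonical cover\<close>

locale bratteli_extension =
  fixes B Bh :: "('v, 'e) bratteli"
  assumes extension: "bratteli_diagram Bh" and nested: "nested B Bh"
begin

abbreviation cover :: "('v cover_vert, 'e cover_edge) bratteli" where
  "cover \<equiv> canonical_cover Bh B"

abbreviation cover_tower :: "(nat \<Rightarrow> 'e cover_edge) set" where
  "cover_tower \<equiv> tower cover (unprimed_base B)"

lemma edges_subset: "e \<in> edges B i \<Longrightarrow> e \<in> edges Bh i"
  using nested unfolding nested_def by blast

lemma base_src_tgt: "e \<in> edges B i \<Longrightarrow> src B i e = src Bh i e" "e \<in> edges B i \<Longrightarrow> tgt B i e = tgt Bh i e"
  using nested unfolding nested_def by blast+

lemma cover_edges_simps [simp]: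
  "Edge a \<in> edges cover i \<longleftrightarrow> a \<in> edges B i"
  "Cross a \<in> edges cover i \<longleftrightarrow> a \<in> edges Bh i \<and> a \<notin> edges B i"
  "Edge' a \<in> edges cover i \<longleftrightarrow> a \<in> edges Bh i"
  "src cover = cover_src Bh" "tgt cover = cover_tgt Bh"
  "e \<in> edges (unprimed_base B) i \<longleftrightarrow> (\<exists>a\<in>edges B i. e = Edge a)"
  by (auto simp: canonical_cover_def unprimed_base_def)

lemma cover_phi_edge:
  assumes "e \<in> edges cover i"
  shows "cover_phi e \<in> edges Bh i"
  using assms edges_subset by (cases e) auto

lemma cover_phi_vert_src [simp]: "cover_phi_vert (cover_src Bh i e) = src Bh i (cover_phi e)"
  by (cases e) auto

lemma cover_phi_vert_tgt [simp]: "cover_phi_vert (cover_tgt Bh i e) = tgt Bh i (cover_phi e)"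
  by (cases e) auto

lemma cover_map_path:
  assumes x: "x \<in> path_space cover"
  shows "cover_map x \<in> path_space Bh"
proof -
  have "cover_map x i \<in> edges Bh i \<and>
      tgt Bh i (cover_map x i) = src Bh (Suc i) (cover_map x (Suc i))" for i
    using cover_phi_edge[OF path_spaceD(1)[OF x, of i]]
      arg_cong[OF path_spaceD(2)[OF x, of i], of cover_phi_vert]
    by (simp add: cover_map_def)
  then show ?thesis by (simp add: path_space_def)
qed

lemma primed_path: "p \<in> path_space Bh \<Longrightarrow> (\<lambda>i. Edge' (p i)) \<in> path_space cover"
  by (simp add: path_space_def)

lemma cover_map_primed [simp]: "cover_map (\<lambda>i. Edge' (p i)) = p"
  by (simp add: cover_map_def)

text \<open>The set \<open>N\<close> is the range of levels that are looked at: \<open>UNIV\<close> for infinite paths, and \<open>{..n}\<close> for finite paths. With \<open>N = {..n}\<close> every path is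
  settled at \<open>Suc n\<close>, which makes the lift of a finite path end in an unprimed vertex.\<close>

definition settled :: "nat set \<Rightarrow> (nat \<Rightarrow> 'e) \<Rightarrow> nat \<Rightarrow> bool" where
  "settled N p i \<longleftrightarrow> (\<forall>j\<in>N. i \<le> j \<longrightarrow> p j \<in> edges B j)"

text \<open>The only candidate for a preimage of \<open>p\<close> that eventually runs in the base: it crosses at the last
  edge of \<open>p\<close> outside the base. If \<open>p\<close> leaves the base infinitely often, the lift is primed for ever.\<close>

definition lift :: "nat set \<Rightarrow> (nat \<Rightarrow> 'e) \<Rightarrow> nat \<Rightarrow> 'e cover_edge" where
  "lift N p i = (if settled N p i then Edge (p i)
     else if settled N p (Suc i) then Cross (p i) else Edge' (p i))"

lemma settled_Suc: "i \<in> N \<Longrightarrow> settled N p i \<longleftrightarrow> p i \<in> edges B i \<and> settled N p (Suc i)"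
  unfolding settled_def by (metis Suc_leD Suc_leI le_neq_implies_less order_refl)

lemma cover_map_lift [simp]: "cover_map (lift N p) = p"
  by (auto simp: cover_map_def lift_def)

text \<open>Together with \<open>cover_tgt_lift\<close> this shows that consecutive edges of a lift fit: the vertex at
  level \<open>i\<close> is unprimed exactly if \<open>p\<close> is settled at \<open>i\<close>.\<close>

lemma cover_src_lift:
  "cover_src Bh i (lift N p i) = (if settled N p i then Vert else Vert') (src Bh i (p i))"
  by (simp add: lift_def)

lemma cover_tgt_lift:
  assumes "i \<in> N"
  shows "cover_tgt Bh i (lift N p i) = (if settled N p (Suc i) then Vert else Vert') (tgt Bh i (p i))"
  using settled_Suc[OF assms] by (simp add: lift_def)

lemma lift_edge:
  assumes "i \<in> N" and "p i \<in> edges Bh i"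
  shows "lift N p i \<in> edges cover i"
  using settled_Suc[OF assms(1)] assms(2) by (simp add: lift_def)

lemma lift_path:
  assumes "p \<in> path_space Bh"
  shows "lift UNIV p \<in> path_space cover"
  using path_spaceD[OF assms] by (simp add: path_space_def lift_edge cover_src_lift cover_tgt_lift)

lemma lift_finite_path:
  assumes "finite_path Bh n p"
  shows "finite_path cover n (lift {..n} p)"
  using assms by (simp add: finite_path_def lift_edge cover_src_lift cover_tgt_lift)

lemma cover_tgt_lift_end: "cover_tgt Bh n (lift {..n} p n) = Vert (tgt Bh n (p n))"
  by (simp add: cover_tgt_lift settled_def)

text \<open>The lift looks only forward. This is why the covering map reflects the last level at which two
  paths of the tower differ, and why lifted transformations preserve tails.\<close>

lemma lift_cong_tail:
  assumes "\<forall>i\<ge>n. p i = q i" and "n \<le> i"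
  shows "lift UNIV p i = lift UNIV q i"
  using assms by (simp add: lift_def settled_def)

lemma unprimed_stays_unprimed:
  assumes x: "x \<in> path_space cover" and "x i \<notin> range Edge'" and "i < j"
  shows "x j = Edge (cover_map x j)" and "cover_map x j \<in> edges B j"
proof -
  have step: "x (Suc k) \<in> range Edge" if "x k \<notin> range Edge'" for k
    using path_spaceD(2)[OF x, of k] that by (cases "x k"; cases "x (Suc k)") auto
  have "x j \<in> range Edge"
    using assms(3)
  proof (induction j)
    case 0
    then show ?case by simp
  next
    case (Suc j)
    then have "x j \<notin> range Edge'"
      using assms(2) by (cases "i = j") auto
    then show ?case by (rule step)
  qed
  then show "x j = Edge (cover_map x j)" and "cover_map x j \<in> edges B j"
    using path_spaceD(1)[OF x, of j] by (auto simp: cover_map_def)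
qed

text \<open>If \<open>x\<close> is unprimed at some level of \<open>N\<close>, then it crosses at a level of \<open>N\<close>, or is never
  primed. Since the crossing edge lies outside the base and all later ones in the base, the crossing
  takes place at the last edge outside the base, exactly as for \<open>lift\<close>.\<close>

lemma lift_unique:
  assumes x: "x \<in> path_space cover" and N: "\<And>i j. j \<in> N \<Longrightarrow> i \<le> j \<Longrightarrow> i \<in> N"
    and m: "m \<in> N" "x m \<notin> range Edge'" and i: "i \<in> N"
  shows "x i = lift N (cover_map x) i"
proof -
  have later: "settled N (cover_map x) (Suc k)" if "x k \<notin> range Edge'" for k
    using unprimed_stays_unprimed(2)[OF x that] by (simp add: settled_def)
  show ?thesis
  proof (cases "x i")
    case (Edge a)
    then have "cover_map x i \<in> edges B i"
      using path_spaceD(1)[OF x, of i] by (simp add: cover_map_def)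
    moreover have "settled N (cover_map x) (Suc i)" using Edge later[of i] by auto
    ultimately show ?thesis
      using settled_Suc[OF i] Edge by (simp add: lift_def cover_map_def)
  next
    case (Cross a)
    then have "cover_map x i \<notin> edges B i"
      using path_spaceD(1)[OF x, of i] by (simp add: cover_map_def)
    moreover have "settled N (cover_map x) (Suc i)" using Cross later[of i] by auto
    ultimately show ?thesis
      using settled_Suc[OF i] Cross by (simp add: lift_def cover_map_def)
  next
    case (Edge' a)
    \<comment> \<open>The first edge after level \<open>i\<close> that is not primed starts in a primed vertex, so it is a crossing edge and
      witnesses that the image is not yet settled.\<close>
    have "i < m"
      using unprimed_stays_unprimed(1)[OF x m(2), of i] m(2) Edge' by (cases i m rule: linorder_cases) auto
    define j where "j = (LEAST j. i < j \<and> x j \<notin> range Edge')"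
    have j: "i < j \<and> x j \<notin> range Edge'"
      unfolding j_def by (rule LeastI[of _ m]) (use \<open>i < m\<close> m in blast)
    have "j \<le> m" unfolding j_def by (rule Least_le) (use \<open>i < m\<close> m in blast)
    then have "j \<in> N" using N m by blast
    obtain k where k: "j = Suc k" using j by (cases j) auto
    have "x k \<in> range Edge'"
    proof (cases "i < k")
      case True
      then show ?thesis using not_less_Least[of k "\<lambda>j. i < j \<and> x j \<notin> range Edge'"] k j_def by auto
    next
      case False
      then have "k = i" using j k by simp
      then show ?thesis using Edge' by simp
    qed
    then have "cover_map x j \<notin> edges B j"
      using j k path_spaceD(2)[OF x, of k] path_spaceD(1)[OF x, of j]
      by (cases "x j") (auto simp: cover_map_def)
    then have "\<not> settled N (cover_map x) (Suc i)"
      using j \<open>j \<in> N\<close> unfolding settled_def by (meson Suc_leI)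
    then show ?thesis
      using settled_Suc[OF i] Edge' by (simp add: lift_def cover_map_def)
  qed
qed

lemma stage_lift: "p \<in> tower_stage Bh B m \<Longrightarrow> lift UNIV p \<in> tower_stage cover (unprimed_base B) m"
  using lift_path by (simp add: tower_stage_def lift_def settled_def)

lemma stage_cover_map:
  "x \<in> tower_stage cover (unprimed_base B) m \<Longrightarrow> cover_map x \<in> tower_stage Bh B m"
  using cover_map_path by (fastforce simp: tower_stage_def cover_map_def)

lemma lift_tower: "p \<in> tower Bh B \<Longrightarrow> lift UNIV p \<in> cover_tower"
  using stage_lift unfolding tower_def by blast

lemma cover_map_tower: "x \<in> cover_tower \<Longrightarrow> cover_map x \<in> tower Bh B"
  using stage_cover_map unfolding tower_def by blast

text \<open>A path stays in the base once it has reached an unprimed vertex. So membership in the tower can be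
  read off from a single edge, which is the reason why the tower is open in the cover.\<close>

lemma mem_cover_tower:
  "x \<in> cover_tower \<longleftrightarrow> x \<in> path_space cover \<and> (\<exists>m. x m \<notin> range Edge')"
proof
  assume "x \<in> cover_tower"
  then obtain m where x: "x \<in> path_space cover" and "\<forall>i>m. \<exists>a\<in>edges B i. x i = Edge a"
    by (auto simp: mem_tower)
  then have "x (Suc m) \<notin> range Edge'" by force
  then show "x \<in> path_space cover \<and> (\<exists>m. x m \<notin> range Edge')" using x by blast
next
  assume "x \<in> path_space cover \<and> (\<exists>m. x m \<notin> range Edge')"
  then obtain m where x: "x \<in> path_space cover" and "x m \<notin> range Edge'" by blast
  then have "\<forall>i>m. \<exists>a\<in>edges B i. x i = Edge a"
    using unprimed_stays_unprimed by blast
  then show "x \<in> cover_tower" using x by (auto simp: mem_tower)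
qed

lemma lift_cover_map:
  assumes "x \<in> cover_tower"
  shows "lift UNIV (cover_map x) = x"
proof
  fix i
  obtain m where "x \<in> path_space cover" and "x m \<notin> range Edge'"
    using assms mem_cover_tower by blast
  then show "lift UNIV (cover_map x) i = x i"
    by (intro lift_unique[symmetric, of x UNIV m]) simp_all
qed

lemma not_tower_primed:
  assumes "x \<in> path_space cover" and "x \<notin> cover_tower"
  shows "x = (\<lambda>i. Edge' (cover_map x i))"
proof
  fix i
  have "x i \<in> range Edge'" using assms mem_cover_tower by blast
  then show "x i = Edge' (cover_map x i)" by (auto simp: cover_map_def)
qed

text \<open>Over a path of the tower lie two paths of the cover, its lift and the path that is primed for
  ever; their tails distinguish them. This is the uniqueness statement behind all identities
  between lifted transformations.\<close>

lemma fiber_tail_unique: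
  assumes x: "x \<in> path_space cover" and y: "y \<in> path_space cover"
    and "cover_map x = cover_map y" and agree: "eventually_agree x y"
  shows "x = y"
proof (cases "x \<in> cover_tower")
  case True
  then have "y \<in> cover_tower"
    using tower_tail_closed y agree eventually_agree_sym by blast
  then show ?thesis using True assms(3) lift_cover_map by metis
next
  case False
  then have "y \<notin> cover_tower" using tower_tail_closed x agree by blast
  then show ?thesis using False assms(3) not_tower_primed x y by metis
qed

section \<open>Block form of the cover matrices\<close>

text \<open>The edges from primed to unprimed vertices are copies of the edges outside the base, whence the
  difference of matrix entries.\<close>

lemma bmatrix_cover:
  "bmatrix cover i (Vert' a) (Vert' b) = bmatrix Bh i a b"
  "bmatrix cover i (Vert a) (Vert b) = bmatrix B i a b"
  "bmatrix cover i (Vert a) (Vert' b) = 0"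
  "int (bmatrix cover i (Vert' a) (Vert b)) = int (bmatrix Bh i a b) - int (bmatrix B i a b)"
proof -
  let ?E = "\<lambda>D. {e \<in> edges D i. src D i e = a \<and> tgt D i e = b}"
  have "{e \<in> edges cover i. cover_src Bh i e = Vert' a \<and> cover_tgt Bh i e = Vert' b} = Edge' ` ?E Bh"
    (is "?X = _")
  proof (rule Set.set_eqI)
    fix e show "e \<in> ?X \<longleftrightarrow> e \<in> Edge' ` ?E Bh" by (cases e) auto
  qed
  then show "bmatrix cover i (Vert' a) (Vert' b) = bmatrix Bh i a b"
    by (simp add: bmatrix_def card_image inj_on_def)
  have "{e \<in> edges cover i. cover_src Bh i e = Vert a \<and> cover_tgt Bh i e = Vert b} = Edge ` ?E B"
    (is "?X = _")
  proof (rule Set.set_eqI)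
    fix e show "e \<in> ?X \<longleftrightarrow> e \<in> Edge ` ?E B" using base_src_tgt by (cases e) auto
  qed
  then show "bmatrix cover i (Vert a) (Vert b) = bmatrix B i a b"
    by (simp add: bmatrix_def card_image inj_on_def)
  have "{e \<in> edges cover i. cover_src Bh i e = Vert a \<and> cover_tgt Bh i e = Vert' b} = {}"
    (is "?X = _")
  proof (rule Set.set_eqI)
    fix e show "e \<in> ?X \<longleftrightarrow> e \<in> {}" by (cases e) auto
  qed
  then show "bmatrix cover i (Vert a) (Vert' b) = 0"
    by (simp only: bmatrix_def cover_edges_simps card.empty)
  have "{e \<in> edges cover i. cover_src Bh i e = Vert' a \<and> cover_tgt Bh i e = Vert b}
      = Cross ` (?E Bh - ?E B)" (is "?X = _")
  proof (rule Set.set_eqI)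
    fix e show "e \<in> ?X \<longleftrightarrow> e \<in> Cross ` (?E Bh - ?E B)" using base_src_tgt by (cases e) auto
  qed
  then have card: "bmatrix cover i (Vert' a) (Vert b) = card (?E Bh - ?E B)"
    by (simp add: bmatrix_def card_image inj_on_def)
  have sub: "?E B \<subseteq> ?E Bh" using base_src_tgt edges_subset by auto
  have fin: "finite (?E Bh)" using extension by (simp add: bratteli_diagram_def)
  show "int (bmatrix cover i (Vert' a) (Vert b)) = int (bmatrix Bh i a b) - int (bmatrix B i a b)"
    using card_mono[OF fin sub] card_Diff_subset[OF finite_subset[OF sub fin] sub]
    unfolding card by (simp add: bmatrix_def of_nat_diff)
qed

lemma cover_block_form:
  "ordered_matrix cover (\<lambda>j. map Vert' (as j) @ map Vert (as j)) i =
     four_block_mat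
       (ordered_matrix Bh as i) (ordered_matrix Bh as i - ordered_matrix B as i)
       (0\<^sub>m (length (as i)) (length (as (Suc i)))) (ordered_matrix B as i)"
  by (rule eq_matI) (auto simp: ordered_matrix_def nth_append bmatrix_cover)

section \<open>Density and openness of the towers\<close>

lemma base_path_subset: "path_space B \<subseteq> path_space Bh"
proof
  fix x assume x: "x \<in> path_space B"
  show "x \<in> path_space Bh"
    using path_spaceD[OF x] edges_subset base_src_tgt by (simp add: path_space_def)
qed

lemma tower_dense:
  assumes prim: "primitive_diagram Bh" and "path_space B \<noteq> {}"
  shows "path_topology Bh closure_of tower Bh B = path_space Bh"
proof -
  obtain y where y: "y \<in> path_space B" using assms(2) by blast
  then have "y \<in> tower Bh B" using base_path_subset by (auto simp: mem_tower path_space_def)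
  then show ?thesis
    using y base_path_subset tower_tail_closed
    by (intro primitive_tail_class_dense[OF extension prim, of y]) blast+
qed

text \<open>The tail class of a path outside the tower is dense and avoids the tower.\<close>

lemma tower_interior_empty:
  assumes prim: "primitive_diagram Bh" and "tower Bh B \<noteq> path_space Bh"
  shows "path_topology Bh interior_of tower Bh B = {}"
proof -
  obtain x where x: "x \<in> path_space Bh" "x \<notin> tower Bh B"
    using assms(2) mem_tower[of _ Bh B] by blast
  then have "path_topology Bh closure_of (path_space Bh - tower Bh B) = path_space Bh"
    using tower_tail_closed eventually_agree_sym
    by (intro primitive_tail_class_dense[OF extension prim, of x]) blast+
  then show ?thesis by (simp add: interior_of_closure_of)
qed

text \<open>Around a point \<open>x\<close> of the tower with the tail of a base path \<open>y\<close>, take the cylinder up to a level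
  \<open>N\<close> beyond which \<open>x\<close> and \<open>y\<close> agree and at which the cylinder of \<open>y\<close> lies in the base. Every path
  of the cylinder of \<open>x\<close> becomes a base path when its prefix is replaced by that of \<open>y\<close>; so its
  edges beyond \<open>N\<close> are base edges.\<close>

lemma tower_open:
  assumes op: "openin (path_topology Bh) (path_space B)" and acc: "base_accessible Bh B"
  shows "openin (path_topology Bh) (tower Bh B)"
  unfolding openin_path_topology_iff
proof (intro conjI ballI)
  show "tower Bh B \<subseteq> path_space Bh" by (auto simp: mem_tower)
  fix x assume x: "x \<in> tower Bh B"
  then have xp: "x \<in> path_space Bh" by (simp add: mem_tower)
  obtain y where y: "y \<in> path_space B" and "eventually_agree x y"
    using acc x unfolding base_accessible_def by blast
  then obtain k where k: "\<forall>i\<ge>k. x i = y i" unfolding eventually_agree_def by blast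
  obtain n where n: "thin_cylinder Bh n y \<subseteq> path_space B"
    using op y unfolding openin_path_topology_iff by blast
  let ?N = "max n k"
  have yh: "y \<in> path_space Bh" using y base_path_subset by blast
  have "thin_cylinder Bh ?N x \<subseteq> tower Bh B"
  proof
    fix z assume "z \<in> thin_cylinder Bh ?N x"
    then have z: "z \<in> path_space Bh" and zx: "\<forall>i\<le>?N. z i = x i"
      unfolding mem_thin_cylinder by blast+
    have "tgt Bh ?N (y ?N) = src Bh (Suc ?N) (z (Suc ?N))"
      using path_spaceD(2)[OF z, of ?N] zx k by simp
    then have "replace_prefix ?N y z \<in> path_space Bh"
      by (intro replace_prefix_path finite_path_prefix yh z)
    moreover have "\<forall>i\<le>n. replace_prefix ?N y z i = y i"
      by (simp add: replace_prefix_def le_max_iff_disj)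
    ultimately have w: "replace_prefix ?N y z \<in> path_space B"
      using n unfolding subset_iff mem_thin_cylinder by blast
    have "z i \<in> edges B i" if "i > ?N" for i
      using path_spaceD(1)[OF w, of i] that by (simp add: replace_prefix_def)
    then show "z \<in> tower Bh B" using z unfolding mem_tower by blast
  qed
  then show "\<exists>n. thin_cylinder Bh n x \<subseteq> tower Bh B" ..
qed

lemma cover_tower_open: "openin (path_topology cover) cover_tower"
  unfolding openin_path_topology_iff
proof (intro conjI ballI)
  show "cover_tower \<subseteq> path_space cover" by (auto simp: mem_tower)
  fix x assume "x \<in> cover_tower"
  then obtain m where m: "x m \<notin> range Edge'" unfolding mem_cover_tower by blast
  have "thin_cylinder cover m x \<subseteq> cover_tower"
  proof
    fix z assume "z \<in> thin_cylinder cover m x"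
    then have "z \<in> path_space cover" and "z m = x m" unfolding mem_thin_cylinder by blast+
    then show "z \<in> cover_tower" using m unfolding mem_cover_tower by metis
  qed
  then show "\<exists>n. thin_cylinder cover n x \<subseteq> cover_tower" ..
qed

section \<open>Topology of the covering map\<close>

lemma cover_map_cylinder:
  assumes "z \<in> thin_cylinder cover n x"
  shows "cover_map z \<in> thin_cylinder Bh n (cover_map x)"
  using assms cover_map_path by (simp add: cover_map_def)

lemma cover_map_continuous: "continuous_map (path_topology cover) (path_topology Bh) cover_map"
  unfolding continuous_map_def topspace_path_topology
proof (intro conjI allI impI)
  show "cover_map \<in> path_space cover \<rightarrow> path_space Bh" using cover_map_path by blast
  fix U assume U: "openin (path_topology Bh) U"
  show "openin (path_topology cover) {x \<in> path_space cover. cover_map x \<in> U}"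
    unfolding openin_path_topology_iff
  proof (intro conjI ballI)
    fix x assume "x \<in> {x \<in> path_space cover. cover_map x \<in> U}"
    then obtain n where "thin_cylinder Bh n (cover_map x) \<subseteq> U"
      using U unfolding openin_path_topology_iff by blast
    then have "thin_cylinder cover n x \<subseteq> {x \<in> path_space cover. cover_map x \<in> U}"
      using cover_map_cylinder thin_cylinder_subset by blast
    then show "\<exists>n. thin_cylinder cover n x \<subseteq> {x \<in> path_space cover. cover_map x \<in> U}" ..
  qed blast
qed

lemma cover_map_surj: "cover_map ` path_space cover = path_space Bh"
proof
  show "cover_map ` path_space cover \<subseteq> path_space Bh" using cover_map_path by blast
  show "path_space Bh \<subseteq> cover_map ` path_space cover"
    by (metis cover_map_primed imageI primed_path subsetI)
qed

text \<open>Continuity of the inverse has to be checked on stage \<open>m\<close> only. There all edges beyond level \<open>m\<close>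
  belong to the base, so that two paths which agree up to \<open>max n m\<close> cross at the same level and have
  lifts that agree up to \<open>n\<close>.\<close>

lemma cover_map_tower_homeomorphic:
  "homeomorphic_map (tower_topology cover (unprimed_base B)) (tower_topology Bh B) cover_map"
  unfolding homeomorphic_map_def quotient_map_def topspace_tower_topology
proof (intro conjI allI impI)
  show "inj_on cover_map cover_tower"
    by (rule inj_on_inverseI[of _ "lift UNIV"]) (rule lift_cover_map)
  show "cover_map ` cover_tower = tower Bh B"
  proof
    show "cover_map ` cover_tower \<subseteq> tower Bh B" using cover_map_tower by blast
    show "tower Bh B \<subseteq> cover_map ` cover_tower"
      by (metis cover_map_lift imageI lift_tower subsetI)
  qed
next
  fix U assume U: "U \<subseteq> tower Bh B"
  let ?V = "{x \<in> cover_tower. cover_map x \<in> U}"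
  let ?S = "tower_stage Bh B" and ?S' = "tower_stage cover (unprimed_base B)"
  show "openin (tower_topology cover (unprimed_base B)) ?V \<longleftrightarrow> openin (tower_topology Bh B) U"
  proof
    assume V: "openin (tower_topology cover (unprimed_base B)) ?V"
    show "openin (tower_topology Bh B) U"
      unfolding openin_tower_topology_iff
    proof (intro conjI allI ballI U)
      fix m p assume p: "p \<in> U \<inter> ?S m"
      then have "lift UNIV p \<in> ?V \<inter> ?S' m"
        using stage_lift lift_tower U by auto
      then obtain n where n: "thin_cylinder cover n (lift UNIV p) \<inter> ?S' m \<subseteq> ?V"
        using V unfolding openin_tower_topology_iff by blast
      have "thin_cylinder Bh (max n m) p \<inter> ?S m \<subseteq> U"
      proof
        fix q assume q: "q \<in> thin_cylinder Bh (max n m) p \<inter> ?S m"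
        then have agree: "\<forall>i\<le>max n m. q i = p i" unfolding Int_iff mem_thin_cylinder by blast
        have "q j \<in> edges B j \<longleftrightarrow> p j \<in> edges B j" for j
          using agree p q by (cases "j \<le> m") (auto simp: tower_stage_def)
        then have "settled UNIV q i \<longleftrightarrow> settled UNIV p i" for i
          by (simp add: settled_def)
        then have "\<forall>i\<le>n. lift UNIV q i = lift UNIV p i" using agree by (simp add: lift_def)
        moreover have "lift UNIV q \<in> ?S' m" using q stage_lift by blast
        moreover have "lift UNIV q \<in> path_space cover" using q lift_path by (simp add: tower_stage_def)
        ultimately have "lift UNIV q \<in> ?V" using n unfolding subset_iff Int_iff mem_thin_cylinder by blast
        then show "q \<in> U" by simp
      qed
      then show "\<exists>n. thin_cylinder Bh n p \<inter> ?S m \<subseteq> U" ..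
    qed
  next
    assume op: "openin (tower_topology Bh B) U"
    show "openin (tower_topology cover (unprimed_base B)) ?V"
      unfolding openin_tower_topology_iff
    proof (intro conjI allI ballI)
      fix m x assume x: "x \<in> ?V \<inter> ?S' m"
      then have "cover_map x \<in> U \<inter> ?S m" using stage_cover_map by blast
      then obtain n where n: "thin_cylinder Bh n (cover_map x) \<inter> ?S m \<subseteq> U"
        using op unfolding openin_tower_topology_iff by blast
      have "thin_cylinder cover n x \<inter> ?S' m \<subseteq> ?V"
        using n cover_map_cylinder stage_cover_map tower_stage_subset by fast
      then show "\<exists>n. thin_cylinder cover n x \<inter> ?S' m \<subseteq> ?V" ..
    qed blast
  qed
qed

section \<open>The covering map conjugates the adic transformations\<close>

text \<open>Among edges that enter the same vertex, those into a primed vertex are all primed copies, and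
  those into an unprimed vertex are copies of base edges or of edges outside the base, which are
  disjoint sets. Therefore the induced order compares distinct edges as distinct edges.\<close>

lemma cover_edge_eqI:
  assumes "e \<in> edges cover i" and "f \<in> edges cover i"
    and "cover_tgt Bh i e = cover_tgt Bh i f" and "cover_phi e = cover_phi f"
  shows "e = f"
  using assms by (cases e; cases f) auto

lemma cover_path_less_iff:
  assumes x: "x \<in> cover_tower" and y: "y \<in> cover_tower"
  shows "path_less cover (induced_order Bh B \<O>) x y \<longleftrightarrow> path_less Bh \<O> (cover_map x) (cover_map y)"
proof -
  have xp: "x \<in> path_space cover" and yp: "y \<in> path_space cover"
    using x y by (simp_all add: mem_tower)
  have "(\<forall>i>k. x i = y i) \<longleftrightarrow> (\<forall>i>k. cover_map x i = cover_map y i)" for k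
  proof
    assume "\<forall>i>k. cover_map x i = cover_map y i"
    then have "\<forall>i\<ge>Suc k. cover_map x i = cover_map y i" by auto
    then have "lift UNIV (cover_map x) i = lift UNIV (cover_map y) i" if "i > k" for i
      using lift_cong_tail[of "Suc k" "cover_map x" "cover_map y" i] that by simp
    then show "\<forall>i>k. x i = y i" by (simp add: lift_cover_map x y)
  qed (simp add: cover_map_def)
  moreover have "x k \<noteq> y k \<and> (x k, y k) \<in> induced_order Bh B \<O> k (cover_tgt Bh k (y k)) \<longleftrightarrow>
      cover_map x k \<noteq> cover_map y k \<and>
      (cover_map x k, cover_map y k) \<in> \<O> k (tgt Bh k (cover_map y k))"
    if agree: "\<forall>i>k. x i = y i" for k
  proof -
    have tgt: "cover_tgt Bh k (x k) = cover_tgt Bh k (y k)"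
      using path_spaceD(2)[OF xp, of k] path_spaceD(2)[OF yp, of k] agree by simp
    have "x k = y k \<longleftrightarrow> cover_map x k = cover_map y k"
      using cover_edge_eqI[OF path_spaceD(1)[OF xp] path_spaceD(1)[OF yp] tgt]
      by (auto simp: cover_map_def)
    then show ?thesis
      using path_spaceD(1)[OF xp, of k] path_spaceD(1)[OF yp, of k] tgt
      by (simp add: induced_order_def cover_map_def)
  qed
  ultimately show ?thesis
    unfolding path_less_def cover_edges_simps by metis
qed

text \<open>Any path between \<open>x\<close> and \<open>y\<close> shares their tail, so it lies in the tower again; on both sides the
  successor is hence determined within the tower, where the covering map is an order isomorphism.\<close>

lemma cover_path_succ_iff:
  assumes x: "x \<in> cover_tower" and y: "y \<in> cover_tower"
  shows "path_succ cover (induced_order Bh B \<O>) x y \<longleftrightarrow> path_succ Bh \<O> (cover_map x) (cover_map y)"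
proof -
  have "(\<exists>z\<in>path_space cover. path_less cover (induced_order Bh B \<O>) x z \<and>
           path_less cover (induced_order Bh B \<O>) z y) \<longleftrightarrow>
        (\<exists>q\<in>path_space Bh. path_less Bh \<O> (cover_map x) q \<and> path_less Bh \<O> q (cover_map y))"
    (is "?L \<longleftrightarrow> ?R")
  proof
    assume ?L
    then obtain z where z: "z \<in> path_space cover"
        "path_less cover (induced_order Bh B \<O>) x z" "path_less cover (induced_order Bh B \<O>) z y"
      by blast
    then have "z \<in> cover_tower"
      using tower_tail_closed[OF x] path_less_eventually_agree eventually_agree_sym by blast
    then show ?R
      using z x y cover_path_less_iff cover_map_path by blast
  next
    assume ?R
    then obtain q where q: "q \<in> path_space Bh"
        "path_less Bh \<O> (cover_map x) q" "path_less Bh \<O> q (cover_map y)"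
      by blast
    then have "q \<in> tower Bh B"
      using tower_tail_closed[OF cover_map_tower[OF x]] path_less_eventually_agree
        eventually_agree_sym by blast
    then have "lift UNIV q \<in> cover_tower" by (rule lift_tower)
    then show ?L
      using q x y cover_path_less_iff[of _ "lift UNIV q"] cover_path_less_iff[of "lift UNIV q"]
      by (metis cover_map_lift mem_tower)
  qed
  then show ?thesis
    using x y cover_map_path cover_path_less_iff[OF x y]
    unfolding path_succ_def mem_tower by blast
qed

lemma path_succ_tower:
  assumes "x \<in> tower Bh' B'" and "path_succ Bh' \<O> x y"
  shows "y \<in> tower Bh' B'"
  using assms path_less_eventually_agree eventually_agree_sym tower_tail_closed
  unfolding path_succ_def by blast

lemma cover_path_succ_unique:
  assumes ord: "bratteli_order Bh \<O>" and x: "x \<in> cover_tower"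
    and y: "path_succ cover (induced_order Bh B \<O>) x y"
    and z: "path_succ cover (induced_order Bh B \<O>) x z"
  shows "y = z"
proof -
  have yz: "y \<in> cover_tower" "z \<in> cover_tower"
    using path_succ_tower[OF x] y z by blast+
  then have "cover_map y = cover_map z"
    using path_succ_unique[OF extension ord] cover_path_succ_iff x y z by blast
  then show ?thesis using lift_cover_map yz by metis
qed

lemma adic_maps_conjugate:
  assumes ord: "bratteli_order Bh \<O>" and x: "x \<in> cover_tower"
  shows "map_option cover_map (adic_map cover (induced_order Bh B \<O>) x) =
     adic_map Bh \<O> (cover_map x)"
proof -
  have down: "adic_map Bh \<O> (cover_map x) = Some q \<longleftrightarrow> path_succ Bh \<O> (cover_map x) q" for q
    by (rule adic_map_Some_iff) (rule path_succ_unique[OF extension ord])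
  have up: "adic_map cover (induced_order Bh B \<O>) x = Some y \<longleftrightarrow>
      path_succ cover (induced_order Bh B \<O>) x y" for y
    by (rule adic_map_Some_iff) (rule cover_path_succ_unique[OF ord x])
  show ?thesis
  proof (cases "adic_map Bh \<O> (cover_map x)")
    case (Some q)
    then have q: "path_succ Bh \<O> (cover_map x) q" by (simp add: down)
    then have "lift UNIV q \<in> cover_tower"
      using path_succ_tower cover_map_tower x lift_tower by blast
    then have "path_succ cover (induced_order Bh B \<O>) x (lift UNIV q)"
      using q by (simp add: cover_path_succ_iff x)
    then have "adic_map cover (induced_order Bh B \<O>) x = Some (lift UNIV q)" using up by blast
    then show ?thesis using Some by simp
  next
    case None
    have "adic_map cover (induced_order Bh B \<O>) x = None"
    proof (rule ccontr)
      assume "adic_map cover (induced_order Bh B \<O>) x \<noteq> None"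
      then obtain y where y: "path_succ cover (induced_order Bh B \<O>) x y" using up by auto
      then have "path_succ Bh \<O> (cover_map x) (cover_map y)"
        using cover_path_succ_iff x path_succ_tower by blast
      then show False using None down by simp
    qed
    then show ?thesis using None by simp
  qed
qed

lemma adic_map_tower:
  assumes "x \<in> tower Bh B" and "bratteli_order Bh \<O>" and "adic_map Bh \<O> x = Some y"
  shows "y \<in> tower Bh B"
proof -
  have "adic_map Bh \<O> x = Some y \<longleftrightarrow> path_succ Bh \<O> x y"
    by (rule adic_map_Some_iff) (rule path_succ_unique[OF extension assms(2)])
  then show ?thesis using assms(1,3) path_succ_tower by blast
qed

lemma adic_map_cover_tower:
  assumes "x \<in> cover_tower" and "bratteli_order Bh \<O>"
    and "adic_map cover (induced_order Bh B \<O>) x = Some y"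
  shows "y \<in> cover_tower"
proof -
  have "adic_map cover (induced_order Bh B \<O>) x = Some y \<longleftrightarrow>
      path_succ cover (induced_order Bh B \<O>) x y"
    by (rule adic_map_Some_iff) (rule cover_path_succ_unique[OF assms(2,1)])
  then show ?thesis using assms(1,3) path_succ_tower by blast
qed

section \<open>Lifting the group\<close>

text \<open>A path over \<open>g (cover_map x)\<close> is chosen of the same kind as \<open>x\<close>, primed for ever or not, because
  the lifted transformation has to preserve tails.\<close>

definition lift_map :: "((nat \<Rightarrow> 'e) \<Rightarrow> (nat \<Rightarrow> 'e)) \<Rightarrow>
    (nat \<Rightarrow> 'e cover_edge) \<Rightarrow> (nat \<Rightarrow> 'e cover_edge)" where
  "lift_map g = (\<lambda>x\<in>path_space cover.
     if x \<in> cover_tower then lift UNIV (g (cover_map x)) else (\<lambda>i. Edge' (g (cover_map x) i)))"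

lemma lift_map_apply:
  assumes g: "g \<in> tail_bijections Bh" and x: "x \<in> path_space cover"
  shows "lift_map g x \<in> path_space cover" and "cover_map (lift_map g x) = g (cover_map x)"
    and "eventually_agree (lift_map g x) x"
proof -
  let ?p = "cover_map x"
  have p: "?p \<in> path_space Bh" by (rule cover_map_path[OF x])
  note gp = tail_bijectionsD(2,3)[OF g p]
  show "lift_map g x \<in> path_space cover"
    using lift_path[OF gp(1)] primed_path[OF gp(1)] x by (simp add: lift_map_def)
  show "cover_map (lift_map g x) = g ?p"
    using x by (simp add: lift_map_def)
  obtain n where n: "\<forall>i\<ge>n. g ?p i = ?p i" using gp(2) unfolding eventually_agree_def by blast
  have "lift_map g x i = x i" if "i \<ge> n" for i
  proof (cases "x \<in> cover_tower")
    case True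
    then show ?thesis
      using lift_cong_tail[OF n that] lift_cover_map[OF True] x by (simp add: lift_map_def)
  next
    case False
    then show ?thesis
      using n that x fun_cong[OF not_tower_primed[OF x False], of i] by (simp add: lift_map_def)
  qed
  then show "eventually_agree (lift_map g x) x" unfolding eventually_agree_def by blast
qed

text \<open>The characterisation of \<open>lift_map g\<close> by which compositions, inverses and swaps are identified.\<close>

lemma lift_map_unique:
  assumes g: "g \<in> tail_bijections Bh" and x: "x \<in> path_space cover" and y: "y \<in> path_space cover"
    and "cover_map y = g (cover_map x)" and "eventually_agree y x"
  shows "lift_map g x = y"
proof (rule fiber_tail_unique[OF lift_map_apply(1)[OF g x] y])
  show "cover_map (lift_map g x) = cover_map y"
    using assms(4) lift_map_apply(2)[OF g x] by simp
  show "eventually_agree (lift_map g x) y"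
    using lift_map_apply(3)[OF g x] assms(5) eventually_agree_sym eventually_agree_trans by blast
qed

lemma lift_map_compose:
  assumes g: "g \<in> tail_bijections Bh" and h: "h \<in> tail_bijections Bh"
    and gh: "compose (path_space Bh) g h \<in> tail_bijections Bh"
  shows "lift_map (compose (path_space Bh) g h) = compose (path_space cover) (lift_map g) (lift_map h)"
proof
  fix x
  show "lift_map (compose (path_space Bh) g h) x =
      compose (path_space cover) (lift_map g) (lift_map h) x"
  proof (cases "x \<in> path_space cover")
    case x: True
    note hx = lift_map_apply[OF h x]
    note ghx = lift_map_apply[OF g hx(1)]
    have "lift_map (compose (path_space Bh) g h) x = lift_map g (lift_map h x)"
    proof (rule lift_map_unique[OF gh x ghx(1)])
      show "cover_map (lift_map g (lift_map h x)) = compose (path_space Bh) g h (cover_map x)"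
        using ghx(2) hx(2) cover_map_path[OF x] by (simp add: compose_def)
      show "eventually_agree (lift_map g (lift_map h x)) x"
        using ghx(3) hx(3) by (rule eventually_agree_trans)
    qed
    then show ?thesis using x by (simp add: compose_def)
  next
    case False
    then show ?thesis by (simp add: compose_def lift_map_def)
  qed
qed

lemma lift_map_tail_bijection:
  assumes g: "g \<in> tail_bijections Bh"
  shows "lift_map g \<in> tail_bijections cover"
proof -
  let ?S = "path_space Bh" and ?T = "path_space cover"
  let ?h = "\<lambda>p\<in>?S. inv_into ?S g p"
  have bij: "bij_betw g ?S ?S" using tail_bijectionsD(1)[OF g] by (simp add: Bij_def)
  have "inv\<^bsub>BijGroup ?S\<^esub> g = ?h" using tail_bijectionsD(1)[OF g] by (rule inv_BijGroup)
  then have h: "?h \<in> tail_bijections Bh"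
    using subgroup.m_inv_closed[OF subgroup_tail_bijections g] by simp
  have inv: "?h (g p) = p" "g (?h p) = p" if "p \<in> ?S" for p
    using that bij tail_bijectionsD(2)[OF g that]
    by (simp_all add: bij_betw_inv_into_left bij_betw_inv_into_right)
  have "bij_betw (lift_map g) ?T ?T"
  proof (rule bij_betw_byWitness[where f' = "lift_map ?h"])
    show "\<forall>x\<in>?T. lift_map ?h (lift_map g x) = x"
    proof
      fix x assume x: "x \<in> ?T"
      note gx = lift_map_apply[OF g x]
      show "lift_map ?h (lift_map g x) = x"
        using gx inv(1)[OF cover_map_path[OF x]] eventually_agree_sym
        by (intro lift_map_unique[OF h gx(1) x]) simp_all
    qed
    show "\<forall>x\<in>?T. lift_map g (lift_map ?h x) = x"
    proof
      fix x assume x: "x \<in> ?T"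
      note hx = lift_map_apply[OF h x]
      show "lift_map g (lift_map ?h x) = x"
        using hx(2,3) inv(2)[OF cover_map_path[OF x]] eventually_agree_sym
        by (intro lift_map_unique[OF g hx(1) x]) simp_all
    qed
    show "lift_map g ` ?T \<subseteq> ?T" using lift_map_apply(1)[OF g] by blast
    show "lift_map ?h ` ?T \<subseteq> ?T" using lift_map_apply(1)[OF h] by blast
  qed
  then show ?thesis
    using lift_map_apply(3)[OF g] by (simp add: tail_bijections_def Bij_def lift_map_def)
qed

text \<open>The homomorphism is stated on all tail-preserving bijections, so that images of generated
  subgroups can be computed on generators.\<close>

lemma lift_map_hom:
  "group_hom (BijGroup (path_space Bh)\<lparr>carrier := tail_bijections Bh\<rparr>)
     (BijGroup (path_space cover)) lift_map"
proof (intro group_hom.intro group_hom_axioms.intro group_BijGroup homI)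
  show "group (BijGroup (path_space Bh)\<lparr>carrier := tail_bijections Bh\<rparr>)"
    by (rule group.subgroup_imp_group[OF group_BijGroup subgroup_tail_bijections])
next
  fix g assume "g \<in> carrier (BijGroup (path_space Bh)\<lparr>carrier := tail_bijections Bh\<rparr>)"
  then show "lift_map g \<in> carrier (BijGroup (path_space cover))"
    using tail_bijectionsD(1)[OF lift_map_tail_bijection] by (simp add: BijGroup_def)
next
  let ?G = "BijGroup (path_space Bh)\<lparr>carrier := tail_bijections Bh\<rparr>"
  fix g h assume "g \<in> carrier ?G" "h \<in> carrier ?G"
  then have g: "g \<in> tail_bijections Bh" and h: "h \<in> tail_bijections Bh" by simp_all
  have mult: "g \<otimes>\<^bsub>?G\<^esub> h = compose (path_space Bh) g h"
    using tail_bijectionsD(1)[OF g] tail_bijectionsD(1)[OF h] by (simp add: BijGroup_def)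
  moreover have "g \<otimes>\<^bsub>?G\<^esub> h \<in> tail_bijections Bh"
    using subgroup.m_closed[OF subgroup_tail_bijections g h] by simp
  moreover have "lift_map g \<otimes>\<^bsub>BijGroup (path_space cover)\<^esub> lift_map h =
      compose (path_space cover) (lift_map g) (lift_map h)"
    using tail_bijectionsD(1)[OF lift_map_tail_bijection[OF g]]
      tail_bijectionsD(1)[OF lift_map_tail_bijection[OF h]] by (simp add: BijGroup_def)
  ultimately show "lift_map (g \<otimes>\<^bsub>?G\<^esub> h) =
      lift_map g \<otimes>\<^bsub>BijGroup (path_space cover)\<^esub> lift_map h"
    using lift_map_compose[OF g h] by simp
qed

text \<open>Whether \<open>x\<close> is primed at level \<open>n\<close> decides which of the two cylinders over a given cylinder it can
  belong to; this lemma and the next one treat the two cases.\<close>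

lemma cylinder_preimage_primed:
  assumes x: "x \<in> path_space cover" and "x n \<in> range Edge'"
  shows "(\<forall>i\<le>n. cover_map x i = e i) \<longleftrightarrow> (\<forall>i\<le>n. x i = Edge' (e i))"
proof -
  have "x i \<in> range Edge'" if "i \<le> n" for i
    using unprimed_stays_unprimed(1)[OF x, of i n] assms(2) that by (cases "i = n") force+
  then have "x i = Edge' (cover_map x i)" if "i \<le> n" for i
    using that by (fastforce simp: cover_map_def)
  then show ?thesis by auto
qed

lemma cylinder_preimage_unprimed:
  assumes x: "x \<in> path_space cover" and "x n \<notin> range Edge'"
  shows "(\<forall>i\<le>n. cover_map x i = e i) \<longleftrightarrow> (\<forall>i\<le>n. x i = lift {..n} e i)"
proof
  assume e: "\<forall>i\<le>n. cover_map x i = e i"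
  have "x i = lift {..n} (cover_map x) i" if "i \<le> n" for i
    by (rule lift_unique[OF x, of _ n]) (use assms(2) that in auto)
  moreover have "lift {..n} (cover_map x) i = lift {..n} e i" if "i \<le> n" for i
    using e that by (simp add: lift_def settled_def)
  ultimately show "\<forall>i\<le>n. x i = lift {..n} e i" by simp
next
  assume "\<forall>i\<le>n. x i = lift {..n} e i"
  then show "\<forall>i\<le>n. cover_map x i = e i"
    using fun_cong[OF cover_map_lift, of "{..n}" e] by (simp add: cover_map_def)
qed

lemma cover_map_replace_prefix:
  "cover_map (replace_prefix n f x) = replace_prefix n (cover_map f) (cover_map x)"
  by (simp add: cover_map_def replace_prefix_def fun_eq_iff)

text \<open>The first factor acts on the paths that are primed at level \<open>n\<close> and the second on the others, so
  on each path at most one of them moves anything.\<close>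

lemma lift_map_cylinder_swap:
  assumes e: "finite_path Bh n e" and f: "finite_path Bh n f"
    and ef: "tgt Bh n (e n) = tgt Bh n (f n)"
  shows "lift_map (cylinder_swap Bh n e f) = compose (path_space cover)
     (cylinder_swap cover n (\<lambda>i. Edge' (e i)) (\<lambda>i. Edge' (f i)))
     (cylinder_swap cover n (lift {..n} e) (lift {..n} f))"
    and "cylinder_swap cover n (\<lambda>i. Edge' (e i)) (\<lambda>i. Edge' (f i)) \<in> cylinder_swaps cover"
    and "cylinder_swap cover n (lift {..n} e) (lift {..n} f) \<in> cylinder_swaps cover"
proof -
  let ?s = "cylinder_swap Bh n e f"
  let ?e' = "\<lambda>i. Edge' (e i)" and ?f' = "\<lambda>i. Edge' (f i)"
  let ?el = "lift {..n} e" and ?fl = "lift {..n} f"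
  let ?s1 = "cylinder_swap cover n ?el ?fl" and ?s2 = "cylinder_swap cover n ?e' ?f'"
  have primed: "finite_path cover n ?e'" "finite_path cover n ?f'"
      "tgt cover n (?e' n) = tgt cover n (?f' n)"
    using e f ef by (simp_all add: finite_path_def)
  have unprimed: "finite_path cover n ?el" "finite_path cover n ?fl"
      "tgt cover n (?el n) = tgt cover n (?fl n)"
    using lift_finite_path e f ef by (simp_all add: cover_tgt_lift_end)
  show "?s2 \<in> cylinder_swaps cover" using primed unfolding cylinder_swaps_def by blast
  show "?s1 \<in> cylinder_swaps cover" using unprimed unfolding cylinder_swaps_def by blast
  have s: "?s \<in> tail_bijections Bh" by (rule cylinder_swap_tail_bijection[OF e f ef])
  have s1: "?s1 \<in> tail_bijections cover" by (rule cylinder_swap_tail_bijection[OF unprimed])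
  have s2: "?s2 \<in> tail_bijections cover" by (rule cylinder_swap_tail_bijection[OF primed])
  have end_unprimed: "lift {..n} p n \<notin> range Edge'" for p
    by (auto simp: lift_def settled_def)
  have Phi: "cover_map (?s2 (?s1 x)) = ?s (cover_map x)" if x: "x \<in> path_space cover" for x
  proof -
    let ?p = "cover_map x"
    note p = cylinder_swap_apply[OF cover_map_path[OF x], of n e f]
    show ?thesis
    proof (cases "x n \<in> range Edge'")
      case True
      have "x n \<noteq> lift {..n} q n" for q using True end_unprimed[of q] by metis
      then have "?s1 x = x" unfolding cylinder_swap_apply[OF x] by auto
      moreover have "?s2 x = (if \<forall>i\<le>n. ?p i = e i then replace_prefix n ?f' x
          else if \<forall>i\<le>n. ?p i = f i then replace_prefix n ?e' x else x)"
        unfolding cylinder_swap_apply[OF x] cylinder_preimage_primed[OF x True] ..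
      ultimately show ?thesis
        unfolding p by (simp only: if_distrib[of cover_map] cover_map_replace_prefix cover_map_primed)
    next
      case False
      have sx: "?s1 x = (if \<forall>i\<le>n. ?p i = e i then replace_prefix n ?fl x
          else if \<forall>i\<le>n. ?p i = f i then replace_prefix n ?el x else x)"
        unfolding cylinder_swap_apply[OF x] cylinder_preimage_unprimed[OF x False] ..
      have "?s1 x n \<notin> range Edge'"
        using False end_unprimed unfolding sx replace_prefix_def by simp
      then have "?s1 x n \<noteq> Edge' a" for a by blast
      then have "?s2 (?s1 x) = ?s1 x"
        unfolding cylinder_swap_apply[OF tail_bijectionsD(2)[OF s1 x]] by auto
      then show ?thesis
        unfolding p sx by (simp only: if_distrib[of cover_map] cover_map_replace_prefix cover_map_lift)
    qed
  qed
  show "lift_map ?s = compose (path_space cover) ?s2 ?s1"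
  proof
    fix x
    show "lift_map ?s x = compose (path_space cover) ?s2 ?s1 x"
    proof (cases "x \<in> path_space cover")
      case x: True
      note x1 = tail_bijectionsD(2)[OF s1 x]
      have "lift_map ?s x = ?s2 (?s1 x)"
        by (rule lift_map_unique[OF s x tail_bijectionsD(2)[OF s2 x1] Phi[OF x]])
           (rule eventually_agree_trans[OF tail_bijectionsD(3)[OF s2 x1] tail_bijectionsD(3)[OF s1 x]])
      then show ?thesis using x by (simp add: compose_def)
    next
      case False
      then show ?thesis by (simp add: compose_def lift_map_def)
    qed
  qed
qed

lemma lift_map_FC: "g \<in> carrier (FC Bh) \<Longrightarrow> lift_map g \<in> carrier (FC cover)"
proof -
  let ?G = "BijGroup (path_space Bh)\<lparr>carrier := tail_bijections Bh\<rparr>"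
  let ?H = "BijGroup (path_space cover)"
  have "lift_map ` cylinder_swaps Bh \<subseteq> carrier (FC cover)"
  proof
    fix h assume "h \<in> lift_map ` cylinder_swaps Bh"
    then obtain n e f where e: "finite_path Bh n e" and f: "finite_path Bh n f"
        and ef: "tgt Bh n (e n) = tgt Bh n (f n)" and h: "h = lift_map (cylinder_swap Bh n e f)"
      unfolding cylinder_swaps_def by blast
    note swap = lift_map_cylinder_swap[OF e f ef]
    have "a \<in> carrier (FC cover)" if "a \<in> cylinder_swaps cover" for a
      using that unfolding carrier_FC by (rule generate.incl)
    then show "h \<in> carrier (FC cover)"
      unfolding h swap(1) using swap(2,3) mult_FC monoid.m_closed[OF group.is_monoid[OF group_FC]] by metis
  qed
  then have "generate ?H (lift_map ` cylinder_swaps Bh) \<subseteq> carrier (FC cover)"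
    by (rule group.generate_subgroup_incl[OF group_BijGroup _ FC_subgroup])
  moreover have "generate ?H (lift_map ` cylinder_swaps Bh) = lift_map ` generate ?G (cylinder_swaps Bh)"
    using group_hom.generate_img[OF lift_map_hom, of "cylinder_swaps Bh"]
      cylinder_swaps_subset[of Bh] by simp
  moreover have "generate ?G (cylinder_swaps Bh) = carrier (FC Bh)"
    unfolding carrier_FC
    by (rule group.generate_consistent[OF group_BijGroup cylinder_swaps_subset subgroup_tail_bijections])
  ultimately show "g \<in> carrier (FC Bh) \<Longrightarrow> lift_map g \<in> carrier (FC cover)" by blast
qed

lemma lift_map_FC_hom: "lift_map \<in> hom (FC Bh) (FC cover)"
proof (rule homI)
  fix g h assume gh: "g \<in> carrier (FC Bh)" "h \<in> carrier (FC Bh)"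
  then have "g \<otimes>\<^bsub>FC Bh\<^esub> h \<in> carrier (FC Bh)"
    using monoid.m_closed[OF group.is_monoid[OF group_FC]] by blast
  then show "lift_map (g \<otimes>\<^bsub>FC Bh\<^esub> h) = lift_map g \<otimes>\<^bsub>FC cover\<^esub> lift_map h"
    using gh lift_map_FC FC_subset_tail_bijections[of Bh] by (simp add: mult_FC lift_map_compose subset_iff)
qed (rule lift_map_FC)

text \<open>An element of the large group moves \<open>x\<close> within its tail class. The images of \<open>x\<close> and of the new
  point also share a tail, so an element of \<open>FC Bh\<close> connects them, and its lift does the same
  upstairs by uniqueness.\<close>

lemma lift_map_orbit:
  assumes x: "x \<in> cover_tower"
  shows "orbit ((FC cover)\<lparr>carrier := lift_map ` carrier (FC Bh)\<rparr>) (acts_on cover_tower) x =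
     orbit (FC cover) (acts_on cover_tower) x"
proof
  show "orbit ((FC cover)\<lparr>carrier := lift_map ` carrier (FC Bh)\<rparr>) (acts_on cover_tower) x
      \<subseteq> orbit (FC cover) (acts_on cover_tower) x"
    using lift_map_FC unfolding orbit_def by auto
  show "orbit (FC cover) (acts_on cover_tower) x
      \<subseteq> orbit ((FC cover)\<lparr>carrier := lift_map ` carrier (FC Bh)\<rparr>) (acts_on cover_tower) x"
  proof
    fix y assume "y \<in> orbit (FC cover) (acts_on cover_tower) x"
    then obtain h where "h \<in> carrier (FC cover)" and y: "y = h x"
      using x by (auto simp: orbit_def acts_on_def)
    then have h: "h \<in> tail_bijections cover" using FC_subset_tail_bijections by blast
    have xp: "x \<in> path_space cover" using x by (simp add: mem_tower)
    have yp: "y \<in> path_space cover" and agree: "eventually_agree y x"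
      using tail_bijectionsD(2,3)[OF h xp] y by simp_all
    have "eventually_agree (cover_map x) (cover_map y)"
      using agree unfolding eventually_agree_def cover_map_def by metis
    then obtain g where g: "g \<in> carrier (FC Bh)" "g (cover_map x) = cover_map y"
      using FC_transitive_on_tail_classes cover_map_path xp yp by blast
    have "g \<in> tail_bijections Bh" using g(1) FC_subset_tail_bijections by blast
    then have "lift_map g x = y"
      using g(2) agree by (intro lift_map_unique xp yp) simp_all
    then show "y \<in> orbit ((FC cover)\<lparr>carrier := lift_map ` carrier (FC Bh)\<rparr>) (acts_on cover_tower) x"
      using g(1) x unfolding orbit_def acts_on_def by (auto intro!: bexI[of _ g])
  qed
qed

end

theorem theorem2p58:
  fixes B Bh :: "('v, 'e) bratteli"
  assumes "bratteli_diagram B" and "bratteli_diagram Bh"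
    and "nested B Bh" and "\<forall>i. verts B i = verts Bh i"
    and "path_space B \<noteq> {}"
  shows
    "(primitive_diagram Bh \<and> tower Bh B \<noteq> path_space Bh \<longrightarrow>
        Abstract_Topology.closure_of (path_topology Bh) (tower Bh B) = path_space Bh \<and>
        Abstract_Topology.interior_of (path_topology Bh) (tower Bh B) = {})
     \<and>
     (\<forall>as. (\<forall>i. distinct (as i) \<and> set (as i) = verts B i) \<longrightarrow>
        (\<forall>i. ordered_matrix (canonical_cover Bh B)
                (\<lambda>j. map Vert' (as j) @ map Vert (as j)) i =
             four_block_mat
               (ordered_matrix Bh as i) (ordered_matrix Bh as i - ordered_matrix B as i)
               (0\<^sub>m (length (as i)) (length (as (Suc i)))) (ordered_matrix B as i)))
     \<and>
     (openin (path_topology Bh) (path_space B) \<and> base_accessible Bh B \<longrightarrow>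
        openin (path_topology Bh) (tower Bh B) \<and>
        (\<exists>\<U>. countable \<U> \<and> disjoint \<U> \<and>
           (\<forall>U\<in>\<U>. openin (path_topology Bh) U \<and> closedin (path_topology Bh) U) \<and>
           \<Union>\<U> = tower Bh B))
     \<and>
     openin (path_topology (canonical_cover Bh B)) (tower (canonical_cover Bh B) (unprimed_base B))
     \<and>
     (continuous_map (path_topology (canonical_cover Bh B)) (path_topology Bh) cover_map \<and>
      cover_map ` path_space (canonical_cover Bh B) = path_space Bh \<and>
      homeomorphic_map (tower_topology (canonical_cover Bh B) (unprimed_base B))
        (tower_topology Bh B) cover_map)
     \<and>
     (\<forall>\<O>. bratteli_order Bh \<O> \<longrightarrow>
        (\<forall>x\<in>tower Bh B. \<forall>y. adic_map Bh \<O> x = Some y \<longrightarrow> y \<in> tower Bh B) \<and>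
        (\<forall>x\<in>tower (canonical_cover Bh B) (unprimed_base B).
           (\<forall>y. adic_map (canonical_cover Bh B) (induced_order Bh B \<O>) x = Some y \<longrightarrow>
              y \<in> tower (canonical_cover Bh B) (unprimed_base B)) \<and>
           map_option cover_map (adic_map (canonical_cover Bh B) (induced_order Bh B \<O>) x) =
             adic_map Bh \<O> (cover_map x)))
     \<and>
     (\<exists>H \<rho>. subgroup H (FC (canonical_cover Bh B)) \<and>
        \<rho> \<in> hom (FC Bh) (FC (canonical_cover Bh B)) \<and> \<rho> ` carrier (FC Bh) = H \<and>
        group_action (FC Bh) (tower Bh B) (acts_on (tower Bh B)) \<and>
        group_action (FC (canonical_cover Bh B))
          (tower (canonical_cover Bh B) (unprimed_base B))
          (acts_on (tower (canonical_cover Bh B) (unprimed_base B))) \<and>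
        (\<forall>g\<in>carrier (FC Bh). \<forall>x\<in>tower (canonical_cover Bh B) (unprimed_base B).
           cover_map (\<rho> g x) = g (cover_map x)) \<and>
        (\<forall>x\<in>tower (canonical_cover Bh B) (unprimed_base B).
           orbit ((FC (canonical_cover Bh B))\<lparr>carrier := H\<rparr>)
             (acts_on (tower (canonical_cover Bh B) (unprimed_base B))) x =
           orbit (FC (canonical_cover Bh B))
             (acts_on (tower (canonical_cover Bh B) (unprimed_base B))) x))"
proof -
  interpret bratteli_extension B Bh
    using assms by unfold_locales auto
  have "group_hom (FC Bh) (FC cover) lift_map"
    by (intro group_hom.intro group_FC group_hom_axioms.intro lift_map_FC_hom)
  then have subgroup: "subgroup (lift_map ` carrier (FC Bh)) (FC cover)"
    by (rule group_hom.img_is_subgroup)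
  have equivariant: "cover_map (lift_map g x) = g (cover_map x)"
    if "g \<in> carrier (FC Bh)" and "x \<in> cover_tower" for g x
    using that FC_subset_tail_bijections by (intro lift_map_apply(2)) (auto simp: mem_tower)
  have group: "subgroup (lift_map ` carrier (FC Bh)) (FC cover) \<and>
      lift_map \<in> hom (FC Bh) (FC cover) \<and>
      lift_map ` carrier (FC Bh) = lift_map ` carrier (FC Bh) \<and>
      group_action (FC Bh) (tower Bh B) (acts_on (tower Bh B)) \<and>
      group_action (FC cover) cover_tower (acts_on cover_tower) \<and>
      (\<forall>g\<in>carrier (FC Bh). \<forall>x\<in>cover_tower. cover_map (lift_map g x) = g (cover_map x)) \<and>
      (\<forall>x\<in>cover_tower.
         orbit ((FC cover)\<lparr>carrier := lift_map ` carrier (FC Bh)\<rparr>) (acts_on cover_tower) x =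
         orbit (FC cover) (acts_on cover_tower) x)"
    by (intro conjI ballI subgroup lift_map_FC_hom refl FC_acts_on_tower equivariant lift_map_orbit)
  show ?thesis
  proof (intro conjI impI allI)
    assume "primitive_diagram Bh \<and> tower Bh B \<noteq> path_space Bh"
    then show "path_topology Bh closure_of tower Bh B = path_space Bh"
      and "path_topology Bh interior_of tower Bh B = {}"
      using tower_dense[OF _ assms(5)] tower_interior_empty by simp_all
  next
    assume "openin (path_topology Bh) (path_space B) \<and> base_accessible Bh B"
    then show op: "openin (path_topology Bh) (tower Bh B)" using tower_open by simp
    show "\<exists>\<U>. countable \<U> \<and> disjoint \<U> \<and>
        (\<forall>U\<in>\<U>. openin (path_topology Bh) U \<and> closedin (path_topology Bh) U) \<and>
        \<Union>\<U> = tower Bh B"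
      by (rule open_disjoint_clopen_union[OF op])
  next
    fix \<O> assume ord: "bratteli_order Bh \<O>"
    show "\<forall>x\<in>tower Bh B. \<forall>y. adic_map Bh \<O> x = Some y \<longrightarrow> y \<in> tower Bh B"
      using ord adic_map_tower by blast
    show "\<forall>x\<in>cover_tower.
        (\<forall>y. adic_map cover (induced_order Bh B \<O>) x = Some y \<longrightarrow> y \<in> cover_tower) \<and>
        map_option cover_map (adic_map cover (induced_order Bh B \<O>) x) =
          adic_map Bh \<O> (cover_map x)"
      using ord adic_map_cover_tower adic_maps_conjugate by blast
  qed (rule cover_block_form cover_tower_open cover_map_continuous cover_map_surj
      cover_map_tower_homeomorphic |
      (rule exI[of _ "lift_map ` carrier (FC Bh)"], rule exI[of _ lift_map], rule group))+
qed

end
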